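(* Let $k\ge 1$ be an integer, $\boldsymbol h\in \mathrm{ord}_p(\mathcal O_{\mathcal K}\setminus\{0\})^k$ and $\boldsymbol d\in\mathbb Z^k$. If $f\in\mathcal H_{\boldsymbol h/\mathcal K}$ satisfies $$f(u_1^{i_1}\epsilon_1-1,\ldots,u_k^{i_k}\epsilon_k-1)=0$$ for each $k$-tuple $\boldsymbol i=(i_1,\dots,i_k)\in[\boldsymbol d,\boldsymbol d+\lfloor\boldsymbol h\rfloor]$ and each $(\epsilon_1,\ldots,\epsilon_k)\in\mu_{p^\infty}^k$, then $f=0$.
   Context: $p$ is a prime, $\mathbb C_p$ is the completion of an algebraic closure of $\mathbb Q_p$, $\mathrm{ord}_p$ is the valuation on $\mathbb C_p$ with $\mathrm{ord}_p(p)=1$. $\mathcal K\subset\mathbb C_p$ is a complete subfield and $\mathcal O_{\mathcal K}$ its ring of integers. $\mu_{p^\infty}$ is the group of all roots of unity of $p$-power order. For each $1\le i\le k$, $u_i$ is a topological generator of $1+2p\mathbb Z_p$. For $\boldsymbol a,\boldsymbol b\in\mathbb R^k$, $\langle\boldsymbol a,\boldsymbol b\rangle_k=\sum a_ib_i$. The order on $\mathbb Z^k$ is componentwise and, for $\boldsymbol d\le\boldsymbol e$ in $\mathbb Z^k$, $[\boldsymbol d,\boldsymbol e]=\{\boldsymbol i\in\mathbb Z^k: \boldsymbol d\le\boldsymbol i\le\boldsymbol e\}$. $\lfloor\boldsymbol h\rfloor=(\lfloor h_1\rfloor,\dots,\lfloor h_k\rfloor)$. For $n\in\mathbb Z_{\ge0}$,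 $\ell(n)$ is the smallest non-negative integer $m$ with $p^m>n$; $\ell(\boldsymbol n)=(\ell(n_1),\dots,\ell(n_k))$. Finally $$\mathcal H_{\boldsymbol h/\mathcal K}=\Big\{\sum_{\boldsymbol n\in\mathbb Z_{\ge0}^k}a_{\boldsymbol n}X^{\boldsymbol n}\in\mathcal K[[X_1,\dots,X_k]]\ \Big|\ \inf_{\boldsymbol n}\{\mathrm{ord}_p(a_{\boldsymbol n})+\langle\boldsymbol h,\ell(\boldsymbol n)\rangle_k\}>-\infty\Big\},\quad X^{\boldsymbol n}=X_1^{n_1}\cdots X_k^{n_k}.$$ Such series converge at every point whose coordinates lie in $\overline{\mathcal K}$ and have strictly positive $\mathrm{ord}_p$. *)

theory Defs
  imports "HOL-Analysis.Analysis" "HOL-Computational_Algebra.Computational_Algebra"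
begin

definition is_subfield :: "'a::field set \<Rightarrow> bool" where
  "is_subfield F \<longleftrightarrow> 0 \<in> F \<and> 1 \<in> F \<and>
     (\<forall>x\<in>F. \<forall>y\<in>F. x + y \<in> F \<and> x * y \<in> F) \<and> (\<forall>x\<in>F. - x \<in> F \<and> inverse x \<in> F)"

definition poly_over :: "'a::field set \<Rightarrow> 'a poly \<Rightarrow> bool" where
  "poly_over F q \<longleftrightarrow> (\<forall>i. coeff q i \<in> F)"

definition is_algebraic_closure_of :: "'a::field set \<Rightarrow> 'a set \<Rightarrow> bool" where
  "is_algebraic_closure_of F L \<longleftrightarrow>
     is_subfield F \<and> is_subfield L \<and> F \<subseteq> L \<and>
     (\<forall>x\<in>L. \<exists>q. poly_over F q \<and> q \<noteq> 0 \<and> poly q x = 0) \<and>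
     (\<forall>q. poly_over L q \<and> degree q > 0 \<longrightarrow> (\<exists>x\<in>L. poly q x = 0))"

(* The ambient type is required to be a completion of an algebraic closure of Q_p, which
   determines it up to an isometric isomorphism.  Its metric (and hence its topology, used
   below for closures, completeness and sums) is the one given by the absolute value
   p powr (- ord x).  The valuation axioms and ord p = 1 force ord to be the p-adic valuation
   on the rationals, so, in the complete ambient field, the topological closure of the
   rationals is their p-adic completion Q_p. *)
definition Qp :: "'c::{field_char_0, metric_space} set" where
  "Qp = closure \<rat>"

locale padic_complex_field =
  fixes p :: nat and ord :: "'c::{field_char_0, metric_space} \<Rightarrow> ereal"
  assumes prime_p: "prime p"
    and ord_not_MInf: "ord x \<noteq> - \<infinity>"
    and ord_eq_PInf_iff: "ord x = \<infinity> \<longleftrightarrow> x = 0"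
    and ord_mult: "ord (x * y) = ord x + ord y"
    and ord_add: "min (ord x) (ord y) \<le> ord (x + y)"
    and ord_p: "ord (of_nat p) = 1"
    and dist_ord: "dist x y = (if x = y then 0 else real p powr (- real_of_ereal (ord (x - y))))"
    and complete_UNIV: "complete (UNIV :: 'c set)"
    and dense_algebraic_closure:
      "\<exists>L :: 'c set. is_algebraic_closure_of Qp L \<and> closure L = UNIV"

definition valuation_ring :: "('c \<Rightarrow> ereal) \<Rightarrow> 'c set \<Rightarrow> 'c set" where
  "valuation_ring ord K = {x \<in> K. ord x \<ge> 0}"

definition Zp :: "('c::{field_char_0, metric_space} \<Rightarrow> ereal) \<Rightarrow> 'c set" where
  "Zp ord = valuation_ring ord Qp"

definition one_plus_2p_Zp ::
    "nat \<Rightarrow> ('c::{field_char_0, metric_space} \<Rightarrow> ereal) \<Rightarrow> 'c set" where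
  "one_plus_2p_Zp p ord = {1 + 2 * of_nat p * z | z. z \<in> Zp ord}"

(* The group 1 + 2 p Z_p is closed in the ambient field, so that the closure may be taken there. *)
definition topological_generator :: "'c::{field, metric_space} set \<Rightarrow> 'c \<Rightarrow> bool" where
  "topological_generator G u \<longleftrightarrow> u \<in> G \<and> closure (range (\<lambda>n::int. u powi n)) = G"

definition mu_p_infinity :: "nat \<Rightarrow> 'c::field set" where
  "mu_p_infinity p = {\<epsilon>. \<exists>m. \<epsilon> ^ (p ^ m) = 1}"

definition ell :: "nat \<Rightarrow> nat \<Rightarrow> nat" where
  "ell p n = (LEAST m. n < p ^ m)"

definition ell_vec :: "nat \<Rightarrow> nat ^ 'k \<Rightarrow> real ^ 'k" where
  "ell_vec p n = (\<chi> i. real (ell p (n $ i)))"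

definition floor_vec :: "real ^ 'k \<Rightarrow> int ^ 'k" where
  "floor_vec h = (\<chi> i. \<lfloor>h $ i\<rfloor>)"

(* A power series in k = CARD('k) variables is the family of its coefficients,
   indexed by the multi-exponents n :: nat ^ 'k. *)
type_synonym ('c, 'k) mpowser = "nat ^ 'k \<Rightarrow> 'c"

definition H_space ::
    "nat \<Rightarrow> ('c \<Rightarrow> ereal) \<Rightarrow> 'c set \<Rightarrow> real ^ 'k::finite \<Rightarrow> ('c, 'k) mpowser set" where
  "H_space p ord K h =
     {a. (\<forall>n. a n \<in> K) \<and> (INF n. ord (a n) + ereal (h \<bullet> ell_vec p n)) > - \<infinity>}"

definition monomial_at :: "nat ^ 'k::finite \<Rightarrow> 'c::field ^ 'k \<Rightarrow> 'c" where
  "monomial_at n x = (\<Prod>i\<in>UNIV. (x $ i) ^ (n $ i))"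

(* Unordered sum in the metric of the ambient field; infsum is 0 where the family is not
   summable, but only points of the open unit polydisc, where series in H_space converge, are used. *)
definition mpowser_eval ::
    "('c::{field, metric_space}, 'k::finite) mpowser \<Rightarrow> 'c ^ 'k \<Rightarrow> 'c" where
  "mpowser_eval a x = (\<Sum>\<^sub>\<infinity>n. a n * monomial_at n x)"

end

theory Submission
  imports Defs
begin

text \<open>
Why a function of growth \<open>h\<close> with this many zeros vanishes. In one variable, put \<open>q = p ^ m\<close>
and let \<open>N = \<lfloor>h\<rfloor> + 1\<close>. The prescribed zeros \<open>u^i \<epsilon> - 1\<close> with \<open>\<epsilon> ^ q = 1\<close> are \<open>N q\<close> distinct points of
order at least \<open>1 / q\<close>. The ultrametric Schwarz lemma (\<open>schwarz_lemma\<close>) divides them out one after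
another: if \<open>ord (a n) + n / q \<ge> B\<close> for all \<open>n\<close>, then \<open>f x\<close> equals \<open>\<Prod> (x - z)\<close> times a number of order
at least \<open>B - N\<close>, because each division costs \<open>1 / q\<close>. The growth condition allows \<open>B = - h m - const\<close>
(\<open>ell_growth\<close>). On the other side, \<open>\<Prod> (x - z)\<close> is the product of the \<open>N\<close> numbers
\<open>(1 + x) ^ q - u ^ (i q)\<close>, and both powers are congruent to \<open>1\<close> modulo \<open>p ^ (m + 1)\<close> as soon as
\<open>ord x \<ge> 1\<close> (\<open>prod_zeros\<close>, \<open>ord_ge_power_p_minus_one\<close>). Altogether
\<open>ord (f x) \<ge> (N - h) m - const\<close> for every \<open>m\<close>, and \<open>N > h\<close> forces \<open>f x = 0\<close>. A series vanishing on a
neighbourhood of \<open>0\<close> has zero coefficients (\<open>identity_theorem\<close>). A topological generator \<open>u\<close> of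
\<open>1 + 2 p \<int>\<^sub>p\<close> is congruent to \<open>1\<close> modulo \<open>p\<close> and is not a root of unity (\<open>topological_generator_facts\<close>);
the former yields the congruence for the powers of \<open>u\<close>, the latter makes the zeros distinct.

In several variables the variables are removed one at a time. Fix all exponents outside a set \<open>S\<close> of
variables and sum over the exponents inside \<open>S\<close> at a point of the grid of zeros. As a function of one
more variable, this partial sum is again a power series (\<open>partial_eval_insert\<close>), its coefficients
satisfy the one-variable growth condition (\<open>partial_eval_bound\<close>), and it vanishes at the zeros
prescribed for that variable. Hence each of its coefficients is zero, and these are the partial sums
for the smaller set. At \<open>S = {}\<close> they are the coefficients of \<open>f\<close>.

The value field carries no type class that makes its addition continuous, so sums are handled through
the valuation directly: a family tending to zero has a sum by completeness, and every identity between
sums is checked modulo elements of order at least \<open>c\<close>, for each real \<open>c\<close>.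
\<close>

section \<open>Lower bounds for the valuation\<close>

context padic_complex_field
begin

text \<open>
Infinite orders only belong to \<open>0\<close>; comparing with a real bound hides them, so that all estimates
below are estimates between real numbers.
\<close>

definition ord_ge :: "real \<Rightarrow> 'c \<Rightarrow> bool" where
  "ord_ge c x \<longleftrightarrow> ereal c \<le> ord x"

lemma ord_zero: "ord 0 = \<infinity>"
  by (simp add: ord_eq_PInf_iff)

lemma ord_nonzero_real: "x \<noteq> 0 \<Longrightarrow> \<exists>r. ord x = ereal r"
  using ord_not_MInf[of x] ord_eq_PInf_iff[of x] by (cases "ord x") auto

lemma ord_one: "ord 1 = 0"
proof -
  obtain r where r: "ord 1 = ereal r" using ord_nonzero_real[of 1] by auto
  then show ?thesis using ord_mult[of 1 1] by (simp add: zero_ereal_def)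
qed

lemma ord_minus: "ord (- x) = ord x"
proof -
  obtain r where r: "ord (- 1) = ereal r" using ord_nonzero_real[of "-1"] by auto
  then have "r = 0" using ord_mult[of "-1" "-1"] ord_one by (simp add: zero_ereal_def)
  then show ?thesis using ord_mult[of "-1" x] r by (simp flip: zero_ereal_def)
qed

lemma ord_ge_zero [simp]: "ord_ge c 0"
  by (simp add: ord_ge_def ord_zero)

lemma ord_ge_mono: "ord_ge c x \<Longrightarrow> d \<le> c \<Longrightarrow> ord_ge d x"
  unfolding ord_ge_def by (meson ereal_less_eq(3) order_trans)

lemma ord_ge_minus [simp]: "ord_ge c (- x) \<longleftrightarrow> ord_ge c x"
  by (simp add: ord_ge_def ord_minus)

lemma ord_ge_add: "ord_ge c x \<Longrightarrow> ord_ge c y \<Longrightarrow> ord_ge c (x + y)"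
  unfolding ord_ge_def using ord_add[of x y] by (meson min.boundedI order_trans)

lemma ord_ge_diff: "ord_ge c x \<Longrightarrow> ord_ge c y \<Longrightarrow> ord_ge c (x - y)"
  using ord_ge_add[of c x "- y"] by simp

lemma ord_ge_sum: "(\<And>i. i \<in> A \<Longrightarrow> ord_ge c (f i)) \<Longrightarrow> ord_ge c (sum f A)"
  by (induction A rule: infinite_finite_induct) (auto intro: ord_ge_add)

lemma ord_ge_mult: "ord_ge c x \<Longrightarrow> ord_ge d y \<Longrightarrow> ord_ge (c + d) (x * y)"
  unfolding ord_ge_def ord_mult by (metis add_mono plus_ereal.simps(1))

lemma ord_ge_one [simp]: "ord_ge c 1 \<longleftrightarrow> c \<le> 0"
  by (simp add: ord_ge_def ord_one)

lemma ord_ge_power: "ord_ge c x \<Longrightarrow> ord_ge (real n * c) (x ^ n)"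
proof (induction n)
  case (Suc n)
  then show ?case using ord_ge_mult[of c x "real n * c" "x ^ n"] by (simp add: algebra_simps)
qed simp

lemma ord_ge_prod:
  "(\<And>i. i \<in> A \<Longrightarrow> ord_ge (c i) (f i)) \<Longrightarrow> ord_ge (sum c A) (prod f A)"
  by (induction A rule: infinite_finite_induct) (auto intro: ord_ge_mult)

lemma ord_ge_of_nat: "ord_ge 0 (of_nat n)"
  by (induction n) (auto intro: ord_ge_add)

lemma ord_ge_1_of_nat: "p dvd n \<Longrightarrow> ord_ge 1 (of_nat n)"
proof -
  assume "p dvd n"
  then obtain k where "n = p * k" ..
  moreover have "ord_ge 1 (of_nat p)" by (simp add: ord_ge_def ord_p)
  ultimately show ?thesis using ord_ge_mult[OF _ ord_ge_of_nat[of k], of 1 "of_nat p"] by simp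
qed

lemma ord_ge_root:
  assumes "ord_ge c (x ^ n)" "n > 0"
  shows "ord_ge (c / real n) x"
proof (cases "x = 0")
  case False
  then obtain r where r: "ord x = ereal r" using ord_nonzero_real by blast
  have "ord (x ^ n) = ereal (real n * r)"
    by (induction n) (simp_all add: ord_one ord_mult r zero_ereal_def algebra_simps)
  then show ?thesis using assms r by (simp add: ord_ge_def field_simps)
qed simp

lemma eq_zero_if_ord_ge: "(\<And>c. ord_ge c x) \<Longrightarrow> x = 0"
  unfolding ord_ge_def by (metis ord_eq_PInf_iff ereal_top)

text \<open>
This lemma and the next translate between the metric and the valuation; only the existence of sums
uses them.
\<close>

lemma ord_ge_of_dist:
  assumes "dist x y < real p powr (- c)"
  shows "ord_ge c (x - y)"
proof (cases "x = y")
  case False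
  then obtain r where r: "ord (x - y) = ereal r" using ord_nonzero_real[of "x - y"] by auto
  have "real p > 1" using prime_gt_1_nat[OF prime_p] by simp
  then show ?thesis using assms False r by (simp add: dist_ord ord_ge_def)
qed simp

lemma dist_le_of_ord_ge:
  assumes "ord_ge c (x - y)"
  shows "dist x y \<le> real p powr (- c)"
proof (cases "x = y")
  case False
  then obtain r where r: "ord (x - y) = ereal r" using ord_nonzero_real[of "x - y"] by auto
  have "real p > 1" using prime_gt_1_nat[OF prime_p] by simp
  then show ?thesis using assms False r by (simp add: dist_ord ord_ge_def)
qed simp

lemma small_radius:
  assumes "e > 0"
  obtains c where "real p powr (- c) < e"
proof -
  have p: "real p > 1" using prime_gt_1_nat[OF prime_p] by simp
  have "real p powr (- (1 - log p e)) = e / p"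
    using p assms by (simp add: powr_diff)
  also have "\<dots> < e" using p assms by (simp add: field_simps)
  finally show ?thesis using that by blast
qed

section \<open>Sums of families tending to zero\<close>

text \<open>
The terms tend to zero along the cofinite filter. In a complete ultrametric field this is equivalent to
summability.
\<close>

definition null_family :: "('i \<Rightarrow> 'c) \<Rightarrow> 'i set \<Rightarrow> bool" where
  "null_family f A \<longleftrightarrow> (\<forall>c. finite {i \<in> A. \<not> ord_ge c (f i)})"

text \<open>
The weight \<open>s\<close> is the degree of a term. Linear growth of the order in the degree suffices, provided
that each degree occurs finitely often.
\<close>

lemma null_familyI:
  fixes s :: "'i \<Rightarrow> nat"
  assumes "\<And>i. i \<in> A \<Longrightarrow> ord_ge (b + c * real (s i)) (f i)" "c > 0"
    and "\<And>r. finite {i \<in> A. s i \<le> r}"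
  shows "null_family f A"
  unfolding null_family_def
proof
  fix e
  have "{i \<in> A. \<not> ord_ge e (f i)} \<subseteq> {i \<in> A. s i \<le> nat \<lceil>(e - b) / c\<rceil>}"
  proof (safe)
    fix i assume i: "i \<in> A" "\<not> ord_ge e (f i)"
    have "b + c * real (s i) < e"
      using i assms(1)[OF i(1)] ord_ge_mono by (meson not_le_imp_less)
    then have "real (s i) < (e - b) / c" using assms(2) by (simp add: field_simps)
    then show "s i \<le> nat \<lceil>(e - b) / c\<rceil>" by linarith
  qed
  then show "finite {i \<in> A. \<not> ord_ge e (f i)}" using assms(3) finite_subset by blast
qed

lemma null_family_subset: "null_family f A \<Longrightarrow> B \<subseteq> A \<Longrightarrow> null_family f B"
  unfolding null_family_def by (rule allI, rule finite_subset[rotated], erule spec) blast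

lemma null_sum_approx:
  assumes "finite G" "F \<subseteq> G" "\<And>i. i \<in> G - F \<Longrightarrow> ord_ge c (f i)"
  shows "ord_ge c (sum f G - sum f F)"
proof -
  have "sum f G - sum f F = sum f (G - F)"
    using sum_diff[OF assms(1,2)] by metis
  then show ?thesis using assms(3) ord_ge_sum by metis
qed

text \<open>
The finite partial sums over the terms of order below \<open>n\<close> form a Cauchy sequence, since by the
ultrametric inequality two of them differ by a sum of small terms. The second conclusion is the only
property of the sum that is used later on.
\<close>

lemma null_family_has_sum:
  assumes "null_family f A"
  obtains s where "(f has_sum s) A"
    and "\<And>c G. finite G \<Longrightarrow> G \<subseteq> A \<Longrightarrow> (\<And>i. i \<in> A - G \<Longrightarrow> ord_ge c (f i)) \<Longrightarrow> ord_ge c (s - sum f G)"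
proof -
  define F where "F c = {i \<in> A. \<not> ord_ge c (f i)}" for c :: real
  have fin: "finite (F c)" for c using assms by (simp add: F_def null_family_def)
  have approx: "ord_ge c (sum f G - sum f (F c))" if "finite G" "F c \<subseteq> G" "G \<subseteq> A" for c G
    by (rule null_sum_approx) (use that in \<open>auto simp: F_def\<close>)
  have Fmono: "F c \<subseteq> F d" if "c \<le> d" for c d
    using that ord_ge_mono by (auto simp: F_def)
  have FA: "F c \<subseteq> A" for c by (auto simp: F_def)
  have "Cauchy (\<lambda>n. sum f (F (real n)))"
  proof (rule metric_CauchyI)
    fix e :: real assume "e > 0"
    then obtain c where c: "real p powr (- c) < e" using small_radius by blast
    show "\<exists>M. \<forall>m\<ge>M. \<forall>n\<ge>M. dist (sum f (F (real m))) (sum f (F (real n))) < e"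
    proof (intro exI allI impI)
      fix m n :: nat assume mn: "nat \<lceil>c\<rceil> \<le> m" "nat \<lceil>c\<rceil> \<le> n"
      then have "ord_ge c (sum f (F (real m)) - sum f (F c))" "ord_ge c (sum f (F (real n)) - sum f (F c))"
        by (intro approx fin Fmono FA, linarith)+
      from ord_ge_diff[OF this] show "dist (sum f (F (real m))) (sum f (F (real n))) < e"
        using c dist_le_of_ord_ge by fastforce
    qed
  qed
  then obtain s where s: "(\<lambda>n. sum f (F (real n))) \<longlonglongrightarrow> s"
    using complete_UNIV unfolding complete_def by auto
  have sF: "ord_ge c (s - sum f (F c))" for c
  proof -
    have "eventually (\<lambda>n. dist (sum f (F (real n))) s < real p powr (- c)) sequentially"
      using prime_gt_1_nat[OF prime_p] by (intro tendstoD[OF s]) simp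
    moreover have "eventually (\<lambda>n. nat \<lceil>c\<rceil> \<le> n) sequentially" by (rule eventually_ge_at_top)
    ultimately have "eventually (\<lambda>n. dist (sum f (F (real n))) s < real p powr (- c) \<and> nat \<lceil>c\<rceil> \<le> n) sequentially"
      by (rule eventually_conj)
    then obtain n where n: "dist (sum f (F (real n))) s < real p powr (- c)" "nat \<lceil>c\<rceil> \<le> n"
      unfolding eventually_sequentially by blast
    have "ord_ge c (sum f (F (real n)) - sum f (F c))"
      using n(2) by (intro approx fin Fmono FA) linarith
    from ord_ge_diff[OF this ord_ge_of_dist[OF n(1)]] show ?thesis by simp
  qed
  show ?thesis
  proof (rule that)
    show "(f has_sum s) A"
      unfolding has_sum_def tendsto_iff
    proof (intro allI impI)
      fix e :: real assume "e > 0"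
      then obtain c where c: "real p powr (- c) < e" using small_radius by blast
      have "dist (sum f G) s < e" if "finite G \<and> F c \<subseteq> G \<and> G \<subseteq> A" for G
      proof -
        have "ord_ge c (sum f G - s)"
          using ord_ge_diff[OF approx[of G c] sF[of c]] that by simp
        then show ?thesis using c dist_le_of_ord_ge by fastforce
      qed
      then show "eventually (\<lambda>G. dist (sum f G) s < e) (finite_subsets_at_top A)"
        unfolding eventually_finite_subsets_at_top using fin[of c] FA[of c] by auto
    qed
    show "ord_ge c (s - sum f G)"
      if "finite G" "G \<subseteq> A" "\<And>i. i \<in> A - G \<Longrightarrow> ord_ge c (f i)" for c G
    proof -
      have "F c \<subseteq> G" using that by (auto simp: F_def)
      then show ?thesis using ord_ge_diff[OF sF[of c] approx[of G c]] that by simp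
    qed
  qed
qed

text \<open>
Modulo elements of order at least \<open>c\<close>, a sum equals any of its finite parts that contains the terms of
smaller order. All manipulations of sums reduce to this congruence.
\<close>

lemma infsum_approx:
  assumes "null_family f A" "finite G" "G \<subseteq> A" "\<And>i. i \<in> A - G \<Longrightarrow> ord_ge c (f i)"
  shows "ord_ge c (infsum f A - sum f G)"
proof -
  obtain s where "(f has_sum s) A" "ord_ge c (s - sum f G)"
    using null_family_has_sum[OF assms(1)] assms(2-) by metis
  then show ?thesis using infsumI by metis
qed

lemma infsum_ord_ge:
  assumes "null_family f A" "\<And>i. i \<in> A \<Longrightarrow> ord_ge c (f i)"
  shows "ord_ge c (infsum f A)"
  using infsum_approx[of f A "{}" c] assms by simp

lemma infsum_eqI:
  assumes "null_family f A"
    and "\<And>c. \<exists>G0. finite G0 \<and> G0 \<subseteq> A \<and>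
           (\<forall>G. finite G \<longrightarrow> G0 \<subseteq> G \<longrightarrow> G \<subseteq> A \<longrightarrow> ord_ge c (s - sum f G))"
  shows "infsum f A = s"
proof -
  have "ord_ge c (infsum f A - s)" for c
  proof -
    obtain G0 where G0: "finite G0" "G0 \<subseteq> A" 
      "\<And>G. finite G \<Longrightarrow> G0 \<subseteq> G \<Longrightarrow> G \<subseteq> A \<Longrightarrow> ord_ge c (s - sum f G)"
      using assms(2) by metis
    define G where "G = G0 \<union> {i \<in> A. \<not> ord_ge c (f i)}"
    have G: "finite G" "G0 \<subseteq> G" "G \<subseteq> A"
      using G0 assms(1) by (auto simp: G_def null_family_def)
    have "ord_ge c (infsum f A - sum f G)"
      by (rule infsum_approx) (use assms(1) G in \<open>auto simp: G_def\<close>)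
    from ord_ge_diff[OF this G0(3)[OF G]] show ?thesis by simp
  qed
  then show ?thesis using eq_zero_if_ord_ge by fastforce
qed

lemma null_family_diff:
  assumes "null_family f A" "null_family g A"
  shows "null_family (\<lambda>i. f i - g i) A"
  unfolding null_family_def
proof
  fix c
  have "{i \<in> A. \<not> ord_ge c (f i - g i)} \<subseteq> {i \<in> A. \<not> ord_ge c (f i)} \<union> {i \<in> A. \<not> ord_ge c (g i)}"
    using ord_ge_diff by blast
  then show "finite {i \<in> A. \<not> ord_ge c (f i - g i)}"
    using assms unfolding null_family_def by (meson finite_UnI finite_subset)
qed

lemma infsum_null_diff:
  assumes "null_family f A" "null_family g A"
  shows "infsum (\<lambda>i. f i - g i) A = infsum f A - infsum g A"
proof (rule infsum_eqI[OF null_family_diff[OF assms]])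
  fix c
  let ?G0 = "{i \<in> A. \<not> ord_ge c (f i)} \<union> {i \<in> A. \<not> ord_ge c (g i)}"
  have "ord_ge c (infsum f A - infsum g A - (\<Sum>i\<in>G. f i - g i))"
    if G: "finite G" "?G0 \<subseteq> G" "G \<subseteq> A" for G
  proof -
    have "ord_ge c (infsum f A - sum f G)" "ord_ge c (infsum g A - sum g G)"
      by (rule infsum_approx; use assms G in auto)+
    from ord_ge_diff[OF this] show ?thesis by (simp add: sum_subtractf algebra_simps)
  qed
  moreover have "finite ?G0" "?G0 \<subseteq> A" using assms by (auto simp: null_family_def)
  ultimately show "\<exists>G0. finite G0 \<and> G0 \<subseteq> A \<and> (\<forall>G. finite G \<longrightarrow> G0 \<subseteq> G \<longrightarrow> G \<subseteq> A \<longrightarrow>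
      ord_ge c (infsum f A - infsum g A - (\<Sum>i\<in>G. f i - g i)))" by blast
qed

text \<open>
The shift is \<open>ord a\<close> if \<open>a \<noteq> 0\<close> and arbitrary otherwise; stating it as an existence claim avoids the case
distinction in each application.
\<close>

lemma ord_ge_mult_left_shift: "\<exists>r. \<forall>c x. ord_ge (c - r) x \<longrightarrow> ord_ge c (a * x)"
proof (cases "a = 0")
  case False
  then obtain r where "ord a = ereal r" using ord_nonzero_real by blast
  then have "ord_ge r a" by (simp add: ord_ge_def)
  then show ?thesis using ord_ge_mult[of r a] by (metis add.commute diff_add_cancel)
qed simp

lemma null_family_cmult:
  assumes "null_family f A"
  shows "null_family (\<lambda>i. a * f i) A"
  unfolding null_family_def
proof
  fix c
  obtain r where r: "\<And>c x. ord_ge (c - r) x \<Longrightarrow> ord_ge c (a * x)"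
    using ord_ge_mult_left_shift by metis
  have "{i \<in> A. \<not> ord_ge c (a * f i)} \<subseteq> {i \<in> A. \<not> ord_ge (c - r) (f i)}" using r by blast
  then show "finite {i \<in> A. \<not> ord_ge c (a * f i)}"
    using assms finite_subset unfolding null_family_def by blast
qed

lemma infsum_null_cmult:
  assumes "null_family f A"
  shows "infsum (\<lambda>i. a * f i) A = a * infsum f A"
proof (rule infsum_eqI[OF null_family_cmult[OF assms]])
  fix c
  obtain r where r: "\<And>c x. ord_ge (c - r) x \<Longrightarrow> ord_ge c (a * x)"
    using ord_ge_mult_left_shift by metis
  let ?G0 = "{i \<in> A. \<not> ord_ge (c - r) (f i)}"
  have "ord_ge c (a * infsum f A - (\<Sum>i\<in>G. a * f i))"
    if G: "finite G" "?G0 \<subseteq> G" "G \<subseteq> A" for G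
  proof -
    have "ord_ge (c - r) (infsum f A - sum f G)"
      by (rule infsum_approx; use assms G in auto)
    from r[OF this] show ?thesis by (simp add: sum_distrib_left algebra_simps)
  qed
  moreover have "finite ?G0" "?G0 \<subseteq> A" using assms by (auto simp: null_family_def)
  ultimately show "\<exists>G0. finite G0 \<and> G0 \<subseteq> A \<and> (\<forall>G. finite G \<longrightarrow> G0 \<subseteq> G \<longrightarrow> G \<subseteq> A \<longrightarrow>
      ord_ge c (a * infsum f A - (\<Sum>i\<in>G. a * f i)))" by blast
qed

text \<open>
Summation by blocks. Only finitely many blocks meet the finite set of terms of order below \<open>c\<close>, so modulo
elements of order at least \<open>c\<close> both sides are the same finite sum.
\<close>

lemma infsum_null_Union:
  assumes null: "null_family f (\<Union>i\<in>I. A i)" and disj: "disjoint_family_on A I"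
  shows "null_family (\<lambda>i. infsum f (A i)) I" (is ?null)
    and "infsum f (\<Union>i\<in>I. A i) = infsum (\<lambda>i. infsum f (A i)) I"
proof -
  let ?U = "\<Union>i\<in>I. A i"
  define F where "F c = {n \<in> ?U. \<not> ord_ge c (f n)}" for c
  define J where "J c = {i \<in> I. A i \<inter> F c \<noteq> {}}" for c
  have fin: "finite (F c)" for c using null by (simp add: null_family_def F_def)
  have finJ: "finite (J c)" for c
  proof -
    have "\<forall>i\<in>J c. \<exists>n. n \<in> A i \<inter> F c" by (auto simp: J_def)
    then obtain g where g: "\<forall>i\<in>J c. g i \<in> A i \<inter> F c" by metis
    have "inj_on g (J c)"
    proof (rule inj_onI, rule ccontr)
      fix i j assume ij: "i \<in> J c" "j \<in> J c" "g i = g j" "i \<noteq> j"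
      then have "A i \<inter> A j = {}" using disj by (auto simp: J_def disjoint_family_on_def)
      moreover have "g i \<in> A i" "g j \<in> A j" using g ij by blast+
      ultimately show False using ij(3) by auto
    qed
    moreover have "g ` J c \<subseteq> F c" using g by blast
    ultimately show ?thesis using fin by (meson inj_on_finite)
  qed
  have inner: "ord_ge c (infsum f (A i) - sum f (A i \<inter> F c))" if "i \<in> I" for i c
  proof (rule infsum_approx)
    show "null_family f (A i)" by (rule null_family_subset[OF null]) (use that in blast)
  qed (use that fin in \<open>auto simp: F_def\<close>)
  show null': ?null
    unfolding null_family_def
  proof
    fix c
    have "{i \<in> I. \<not> ord_ge c (infsum f (A i))} \<subseteq> J c"
      using inner[of _ c] by (force simp: J_def)
    then show "finite {i \<in> I. \<not> ord_ge c (infsum f (A i))}" using finJ finite_subset by blast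
  qed
  have "infsum (\<lambda>i. infsum f (A i)) I = infsum f ?U"
  proof (rule infsum_eqI[OF null'])
    fix c
    have "ord_ge c (infsum f ?U - (\<Sum>i\<in>G. infsum f (A i)))"
      if G: "finite G" "J c \<subseteq> G" "G \<subseteq> I" for G
    proof -
      have "F c = (\<Union>i\<in>G. A i \<inter> F c)" using G by (auto simp: J_def F_def)
      then have "sum f (F c) = sum f (\<Union>i\<in>G. A i \<inter> F c)" by simp
      also have "\<dots> = (\<Sum>i\<in>G. sum f (A i \<inter> F c))"
        proof (intro sum.UNION_disjoint ballI impI)
        fix i j assume ij: "i \<in> G" "j \<in> G" "i \<noteq> j"
        then have "A i \<inter> A j = {}" using disj G(3) unfolding disjoint_family_on_def by blast
        then show "(A i \<inter> F c) \<inter> (A j \<inter> F c) = {}" by blast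
      qed (use G fin in auto)
      finally have eq: "sum f (F c) = (\<Sum>i\<in>G. sum f (A i \<inter> F c))" .
      have "ord_ge c ((\<Sum>i\<in>G. infsum f (A i)) - sum f (F c))"
        unfolding eq sum_subtractf[symmetric] using G inner by (intro ord_ge_sum) blast
      moreover have "ord_ge c (infsum f ?U - sum f (F c))"
        by (rule infsum_approx) (use null fin in \<open>auto simp: F_def\<close>)
      ultimately show ?thesis using ord_ge_diff by fastforce
    qed
    then show "\<exists>G0. finite G0 \<and> G0 \<subseteq> I \<and> (\<forall>G. finite G \<longrightarrow> G0 \<subseteq> G \<longrightarrow> G \<subseteq> I \<longrightarrow>
        ord_ge c (infsum f ?U - (\<Sum>i\<in>G. infsum f (A i))))"
      using finJ[of c] by (intro exI[of _ "J c"]) (auto simp: J_def)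
  qed
  then show "infsum f ?U = infsum (\<lambda>i. infsum f (A i)) I" by simp
qed

lemma null_family_Suc:
  assumes "null_family f (UNIV :: nat set)"
  shows "null_family (\<lambda>n. f (Suc n)) UNIV"
  unfolding null_family_def
proof
  fix c
  have "Suc ` {n \<in> UNIV. \<not> ord_ge c (f (Suc n))} \<subseteq> {n \<in> UNIV. \<not> ord_ge c (f n)}" by auto
  then show "finite {n \<in> UNIV. \<not> ord_ge c (f (Suc n))}"
    using assms unfolding null_family_def by (meson finite_imageD finite_subset inj_Suc inj_on_subset subset_UNIV)
qed

lemma infsum_null_Suc:
  assumes null: "null_family f (UNIV :: nat set)"
  shows "infsum f UNIV = f 0 + infsum (\<lambda>n. f (Suc n)) UNIV"
proof (rule infsum_eqI[OF null])
  fix c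
  let ?G0 = "insert 0 {n \<in> UNIV. \<not> ord_ge c (f n)}"
  have "ord_ge c (f 0 + infsum (\<lambda>n. f (Suc n)) UNIV - sum f G)"
    if G: "finite G" "?G0 \<subseteq> G" for G
  proof -
    let ?H = "Suc -` G"
    have GH: "G = insert 0 (Suc ` ?H)"
    proof (rule set_eqI)
      show "n \<in> G \<longleftrightarrow> n \<in> insert 0 (Suc ` ?H)" for n using G by (cases n) auto
    qed
    have fH: "finite ?H" using G by (intro finite_vimageI) auto
    have "sum f G = f 0 + (\<Sum>n\<in>?H. f (Suc n))"
    proof -
      have "sum f G = sum f (insert 0 (Suc ` ?H))" using GH by simp
      also have "\<dots> = f 0 + sum f (Suc ` ?H)" using fH by (intro sum.insert finite_imageI) auto
      also have "sum f (Suc ` ?H) = (\<Sum>n\<in>?H. f (Suc n))" by (subst sum.reindex) auto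
      finally show ?thesis .
    qed
    moreover have "ord_ge c (infsum (\<lambda>n. f (Suc n)) UNIV - (\<Sum>n\<in>?H. f (Suc n)))"
      by (rule infsum_approx[OF null_family_Suc[OF null] fH]) (use G in auto)
    ultimately show ?thesis by simp
  qed
  then show "\<exists>G0. finite G0 \<and> G0 \<subseteq> UNIV \<and> (\<forall>G. finite G \<longrightarrow> G0 \<subseteq> G \<longrightarrow> G \<subseteq> UNIV \<longrightarrow>
      ord_ge c (f 0 + infsum (\<lambda>n. f (Suc n)) UNIV - sum f G))"
    using null by (intro exI[of _ ?G0]) (auto simp: null_family_def)
qed

end

section \<open>Roots of unity of prime power order\<close>

lemma sum_of_powers_eq_zero_imp_root_of_unity:
  fixes z :: "'a::idom"
  assumes "(\<Sum>i<n. z ^ i) = 0"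
  shows "z ^ n = 1"
  using power_diff_1_eq[of z n] assms by simp

text \<open>
If \<open>z ^ j = 1\<close> for some \<open>0 < j < p ^ Suc m\<close>, then by Bezout \<open>z\<close> to the power \<open>gcd j (p ^ Suc m)\<close> is \<open>1\<close>. This
greatest common divisor is a proper divisor of \<open>p ^ Suc m\<close>, hence divides \<open>p ^ m\<close>, contradicting
\<open>z ^ (p ^ m) \<noteq> 1\<close>.
\<close>

lemma prime_power_order_inj:
  fixes z :: "'a::field"
  assumes "prime p" "z ^ (p ^ Suc m) = 1" "z ^ (p ^ m) \<noteq> 1"
  shows "inj_on (\<lambda>j. z ^ j) {..<p ^ Suc m}"
proof -
  have z0: "z \<noteq> 0" using assms(1,2) prime_gt_0_nat[of p] by (auto simp: power_0_left split: if_splits)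
  have no: "z ^ j \<noteq> 1" if j: "0 < j" "j < p ^ Suc m" for j
  proof
    assume zj: "z ^ j = 1"
    obtain x y where xy: "j * x = p ^ Suc m * y + gcd j (p ^ Suc m)"
      using bezout_nat[of j "p ^ Suc m"] j by auto
    have "z ^ (j * x) = 1" by (simp add: power_mult zj)
    moreover have "z ^ (p ^ Suc m * y + gcd j (p ^ Suc m)) = z ^ gcd j (p ^ Suc m)"
      unfolding power_add power_mult using assms(2) by simp
    ultimately have zg: "z ^ gcd j (p ^ Suc m) = 1" using xy by simp
    obtain s where s: "s \<le> Suc m" "gcd j (p ^ Suc m) = p ^ s"
      using divides_primepow_nat[OF assms(1)] by (metis gcd_dvd2)
    have "gcd j (p ^ Suc m) \<le> j" using j by (simp add: dvd_imp_le)
    then have "s \<noteq> Suc m" using s j by (metis leD)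
    then have "p ^ m = p ^ s * p ^ (m - s)" using s by (simp flip: power_add)
    then have "z ^ (p ^ m) = (z ^ (p ^ s)) ^ (p ^ (m - s))" by (simp add: power_mult)
    then show False using zg s assms(3) by simp
  qed
  show ?thesis
  proof (rule linorder_inj_onI)
    fix i j assume ij: "i < j" "i \<in> {..<p ^ Suc m}" "j \<in> {..<p ^ Suc m}"
    show "z ^ i \<noteq> z ^ j"
    proof
      assume "z ^ i = z ^ j"
      also have "z ^ j = z ^ i * z ^ (j - i)" using ij by (simp flip: power_add)
      finally have "z ^ (j - i) = 1" using z0 by simp
      then show False using no[of "j - i"] ij by (simp add: less_imp_diff_less)
    qed
  qed auto
qed

lemma degree_monom_minus_one:
  assumes "q > 0"
  shows "degree (monom 1 q - 1 :: 'a::comm_ring_1 poly) = q"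
proof -
  have "degree (monom 1 q + (- 1) :: 'a poly) = degree (monom 1 q :: 'a poly)"
    using assms by (intro degree_add_eq_left) (simp add: degree_monom_eq)
  then show ?thesis by (simp add: degree_monom_eq)
qed

text \<open>
The factorisation of \<open>X ^ q - 1\<close> into linear factors, made homogeneous by the substitution \<open>X = x / w\<close>. Both
sides are monic of degree \<open>q\<close> and agree at the \<open>q\<close> roots of unity.
\<close>

lemma prod_roots_of_unity:
  fixes x w :: "'a::field"
  assumes card: "card {\<epsilon> :: 'a. \<epsilon> ^ q = 1} = q" and "q > 0" "w \<noteq> 0"
  shows "(\<Prod>\<epsilon>\<in>{\<epsilon>. \<epsilon> ^ q = 1}. x - w * \<epsilon>) = x ^ q - w ^ q"
proof -
  let ?M = "{\<epsilon> :: 'a. \<epsilon> ^ q = 1}"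
  let ?P = "\<Prod>\<epsilon>\<in>?M. [:-\<epsilon>, 1:]" and ?Q = "monom 1 q - 1 :: 'a poly"
  have fin: "finite ?M" using card assms(2) by (metis card.infinite less_irrefl)
  have degP: "degree ?P = q" by (subst degree_prod_eq_sum_degree) (use card in auto)
  moreover have "lead_coeff ?P = 1" by (simp add: lead_coeff_prod)
  ultimately have "coeff ?P q = 1" by simp
  moreover have "degree ?Q = q"
    using assms(2) by (rule degree_monom_minus_one)
  moreover have "coeff ?Q q = 1" using assms(2) by (simp add: coeff_diff)
  ultimately have "?P = ?Q"
    using degP card fin
    by (intro poly_eqI_degree_lead_coeff[of _ q _ ?M])
       (auto simp: poly_prod poly_monom prod_zero_iff)
  then have "poly ?P (x / w) = poly ?Q (x / w)" by simp
  then have eq: "(\<Prod>\<epsilon>\<in>?M. x / w - \<epsilon>) = (x / w) ^ q - 1" by (simp add: poly_prod poly_monom)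
  have "(\<Prod>\<epsilon>\<in>?M. x - w * \<epsilon>) = (\<Prod>\<epsilon>\<in>?M. w * (x / w - \<epsilon>))"
    using assms(3) by (intro prod.cong) (auto simp: field_simps)
  also have "\<dots> = w ^ q * ((x / w) ^ q - 1)" by (simp add: prod.distrib card eq)
  also have "\<dots> = x ^ q - w ^ q" using assms(3) by (simp add: field_simps power_divide)
  finally show ?thesis .
qed

context padic_complex_field
begin

text \<open>
A primitive root is built inside the dense algebraically closed subfield: a root \<open>z1\<close> of
\<open>1 + X + \<dots> + X ^ (p - 1)\<close> is a root of unity other than \<open>1\<close> because \<open>p \<noteq> 0\<close>, and extracting \<open>p\<close>-th roots
of \<open>z1\<close> repeatedly gives an element of order \<open>p ^ m\<close>, whose powers exhaust the roots of unity.
\<close>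

lemma card_roots_of_unity: "card {\<epsilon> :: 'c. \<epsilon> ^ (p ^ m) = 1} = p ^ m"
proof (cases m)
  case (Suc n)
  obtain L :: "'c set" where L: "is_algebraic_closure_of Qp L"
    using dense_algebraic_closure by blast
  have root: "\<exists>x\<in>L. poly q x = 0" if "poly_over L q" "degree q > 0" for q
    using L that unfolding is_algebraic_closure_of_def by blast
  have L01: "0 \<in> L" "1 \<in> L" "\<And>x. x \<in> L \<Longrightarrow> - x \<in> L"
    using L unfolding is_algebraic_closure_of_def is_subfield_def by auto
  have p: "p > 1" using prime_gt_1_nat[OF prime_p] .
  obtain z1 where z1: "z1 \<in> L" "(\<Sum>i<p. z1 ^ i) = 0"
  proof -
    let ?q = "\<Sum>i<p. monom 1 i :: 'c poly"
    have c: "coeff ?q i = (if i < p then 1 else 0)" for i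
      by (simp add: coeff_sum)
    have "poly_over L ?q" using L01 by (simp add: poly_over_def c)
    moreover have "degree ?q \<ge> 1" using p by (intro le_degree) (simp add: c)
    ultimately obtain x where "x \<in> L" "poly ?q x = 0" using root by (metis One_nat_def Suc_le_eq)
    then show ?thesis using that[of x] by (simp add: poly_sum poly_monom)
  qed
  have z1p: "z1 ^ p = 1" using sum_of_powers_eq_zero_imp_root_of_unity[OF z1(2)] .
  have "z1 \<noteq> 1" using z1(2) p by auto
  have "\<exists>z\<in>L. z ^ (p ^ n) = z1" for n
  proof (induction n)
    case (Suc n)
    then obtain z where z: "z \<in> L" "z ^ (p ^ n) = z1" by blast
    let ?q = "monom 1 p - [:z:] :: 'c poly"
    have c: "coeff ?q i = (if i = p then 1 else if i = 0 then - z else 0)" for i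
      using p by (auto simp: coeff_pCons split: nat.split)
    have "poly_over L ?q" unfolding poly_over_def c using L01 z by simp
    moreover have "degree ?q \<ge> p"
    proof (rule le_degree)
      show "coeff ?q p \<noteq> 0" unfolding c by simp
    qed
    ultimately obtain x where "x \<in> L" "poly ?q x = 0" using root p by (metis less_le_trans less_trans zero_less_one)
    then show ?case using z by (intro bexI[of _ x]) (auto simp: poly_monom power_mult)
  qed (use z1 in auto)
  then obtain z where z: "z ^ (p ^ n) = z1" by blast
  have zS: "z ^ (p ^ Suc n) = 1" using z z1p by (simp add: power_mult mult.commute[of p])
  let ?M = "{\<epsilon> :: 'c. \<epsilon> ^ (p ^ Suc n) = 1}"
  have q0: "p ^ Suc n > 0" using p by simp
  have "degree (monom 1 (p ^ Suc n) - 1 :: 'c poly) = p ^ Suc n"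
    using q0 by (rule degree_monom_minus_one)
  moreover have "monom 1 (p ^ Suc n) - 1 \<noteq> (0 :: 'c poly)"
    using calculation q0 by (metis degree_0 less_irrefl)
  moreover have "?M = {x. poly (monom 1 (p ^ Suc n) - 1) x = 0}" by (simp add: poly_monom)
  ultimately have M: "finite ?M" "card ?M \<le> p ^ Suc n"
    using card_poly_roots_bound poly_roots_finite by metis+
  have "inj_on (\<lambda>j. z ^ j) {..<p ^ Suc n}"
    using prime_power_order_inj[OF prime_p zS] z \<open>z1 \<noteq> 1\<close> by simp
  moreover have "(\<lambda>j. z ^ j) ` {..<p ^ Suc n} \<subseteq> ?M"
  proof safe
    show "(z ^ j) ^ (p ^ Suc n) = 1" for j using zS by (metis power_mult mult.commute power_one)
  qed
  ultimately have "card {..<p ^ Suc n} \<le> card ?M" using M(1) by (rule card_inj_on_le)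
  then show ?thesis using M(2) Suc by simp
qed simp

section \<open>Powers close to one\<close>

text \<open>
Raising to the power \<open>p\<close> gains one order: \<open>y ^ p - 1\<close> is \<open>y - 1\<close> times a sum of \<open>p\<close> terms that are
congruent to \<open>1\<close> modulo \<open>p\<close>.
\<close>

lemma ord_ge_power_p_minus_one:
  assumes "ord_ge 1 (y - 1)"
  shows "ord_ge (real m + 1) (y ^ (p ^ m) - 1)"
proof (induction m)
  case (Suc m)
  let ?y = "y ^ (p ^ m)"
  have y1: "ord_ge 1 (?y - 1)" using Suc by (rule ord_ge_mono) simp
  have "ord_ge 0 ?y" using ord_ge_add[OF ord_ge_mono[OF y1, of 0], of 1] by simp
  then have yk: "ord_ge 0 (\<Sum>i<k. ?y ^ i)" for k
    using ord_ge_power[of 0 ?y] by (intro ord_ge_sum) simp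
  have "ord_ge 1 (?y ^ k - 1)" for k
    using ord_ge_mult[OF y1 yk[of k]] by (simp add: power_diff_1_eq)
  then have "ord_ge 1 (\<Sum>i<p. ?y ^ i - 1)" by (intro ord_ge_sum)
  then have "ord_ge 1 ((\<Sum>i<p. ?y ^ i) - of_nat p)" by (simp add: sum_subtractf)
  then have "ord_ge 1 (\<Sum>i<p. ?y ^ i)"
    using ord_ge_add[OF _ ord_ge_1_of_nat[of p]] by fastforce
  from ord_ge_mult[OF Suc this] have "ord_ge (real (Suc m) + 1) (?y ^ p - 1)"
    by (simp add: power_diff_1_eq add_ac)
  then show ?case by (simp add: power_mult mult.commute[of p])
qed (use assms in simp)

text \<open>
All binomial coefficients except the two outer ones are divisible by \<open>p\<close>.
\<close>

lemma freshman_dream_mod_p: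
  assumes "ord_ge 0 w"
  shows "ord_ge 1 ((w + 1) ^ p - (w ^ p + 1))"
proof -
  have p: "p > 0" using prime_gt_0_nat[OF prime_p] .
  have "(w + 1) ^ p = (\<Sum>k\<le>p. of_nat (p choose k) * w ^ k)"
    by (simp add: binomial_ring)
  also have "{..p} = insert 0 (insert p {0<..<p})" using p by auto
  also have "(\<Sum>k\<in>\<dots>. of_nat (p choose k) * w ^ k)
      = 1 + w ^ p + (\<Sum>k\<in>{0<..<p}. of_nat (p choose k) * w ^ k)"
    using p by (subst sum.insert; simp)+
  finally have "(w + 1) ^ p - (w ^ p + 1) = (\<Sum>k\<in>{0<..<p}. of_nat (p choose k) * w ^ k)"
    by simp
  moreover have "ord_ge 1 (of_nat (p choose k) * w ^ k)" if "k \<in> {0<..<p}" for k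
  proof -
    have "p dvd p choose k" using that prime_p by (intro dvd_choose_prime) auto
    from ord_ge_mult[OF ord_ge_1_of_nat[OF this] ord_ge_power[OF assms]] show ?thesis by simp
  qed
  ultimately show ?thesis by (auto intro: ord_ge_sum)
qed

lemma power_cong_mod_p:
  assumes "ord_ge 1 (a - b)" "ord_ge 0 b"
  shows "ord_ge 1 (a ^ n - b ^ n)"
proof (induction n)
  case (Suc n)
  have "ord_ge 0 (a - b)" using assms(1) by (rule ord_ge_mono) simp
  then have a: "ord_ge 0 a" using ord_ge_add[OF _ assms(2)] by fastforce
  have "a ^ Suc n - b ^ Suc n = a * (a ^ n - b ^ n) + (a - b) * b ^ n"
    by (simp add: algebra_simps)
  then show ?case
    using ord_ge_add[OF ord_ge_mult[OF a Suc] _, of "(a - b) * b ^ n"]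
      ord_ge_mult[OF assms(1) ord_ge_power[OF assms(2), of n]] by simp
qed simp

text \<open>
Iterating the congruence \<open>(y - 1) ^ p \<equiv> y ^ p - 1\<close> modulo \<open>p\<close> shows that the \<open>p ^ m\<close>-th power of \<open>y - 1\<close> has
order at least \<open>1\<close>. The comparison is made with \<open>(y - 1) ^ (p ^ m) + 1\<close>, which spares a sign for \<open>p = 2\<close>.
\<close>

lemma ord_ge_minus_one_of_power:
  assumes "ord_ge 0 y" "ord_ge 1 (y ^ (p ^ m) - 1)"
  shows "ord_ge (1 / real (p ^ m)) (y - 1)"
proof -
  let ?w = "y - 1"
  have w: "ord_ge 0 ?w" using ord_ge_diff[OF assms(1), of 1] by simp
  have wn: "ord_ge 0 (?w ^ k)" for k using ord_ge_power[OF w] by simp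
  have "ord_ge 1 (y ^ (p ^ m) - (?w ^ (p ^ m) + 1))"
  proof (induction m)
    case (Suc m)
    let ?v = "?w ^ (p ^ m)"
    have "ord_ge 1 ((y ^ (p ^ m)) ^ p - (?v + 1) ^ p)"
      by (rule power_cong_mod_p[OF Suc]) (use ord_ge_add[OF wn, of 1] in simp)
    from ord_ge_add[OF this freshman_dream_mod_p[OF wn[of "p ^ m"]]]
    have "ord_ge 1 ((y ^ (p ^ m)) ^ p - (?v ^ p + 1))" by (simp only: diff_add_cancel add_diff_eq)
    then show ?case by (simp add: power_mult mult.commute[of p])
  qed simp
  from ord_ge_diff[OF assms(2) this] have "ord_ge 1 (?w ^ (p ^ m))" by simp
  from ord_ge_root[OF this] show ?thesis using prime_gt_0_nat[OF prime_p] by simp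
qed

section \<open>Power series on the open unit disc\<close>

definition series_at :: "(nat \<Rightarrow> 'c) \<Rightarrow> 'c \<Rightarrow> 'c" where
  "series_at a x = infsum (\<lambda>n. a n * x ^ n) UNIV"

text \<open>
These are the coefficient sequences of power series that converge on the open unit disc: the terms
stay bounded at each radius below \<open>1\<close>, and therefore tend to zero at each smaller radius. Dividing
such a series by \<open>X - z\<close> at a zero \<open>z\<close> gives a series of the same kind, so the class is suited to
removing zeros repeatedly.
\<close>

definition open_disc_series :: "(nat \<Rightarrow> 'c) \<Rightarrow> bool" where
  "open_disc_series a \<longleftrightarrow> (\<forall>t>0. \<exists>B. \<forall>n. ord_ge (B - real n * t) (a n))"

text \<open>
The boundedness at the larger radius given by \<open>t / 2\<close> leaves the order \<open>n t / 2\<close> to spare at \<open>x\<close>.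
\<close>

lemma series_null_family:
  assumes "open_disc_series a" "ord_ge t x" "t > 0"
  shows "null_family (\<lambda>n. a (n + k) * x ^ n) UNIV"
proof -
  obtain B where B: "\<And>n. ord_ge (B - real n * (t / 2)) (a n)"
    using assms(1,3) unfolding open_disc_series_def by (metis half_gt_zero)
  show ?thesis
  proof (rule null_familyI[where s = "\<lambda>n. n"])
    fix n
    show "ord_ge (B - real k * (t / 2) + t / 2 * real n) (a (n + k) * x ^ n)"
      using ord_ge_mult[OF B[of "n + k"] ord_ge_power[OF assms(2), of n]]
      by (rule ord_ge_mono) (simp add: field_simps)
  qed (use assms(3) in auto)
qed

lemma series_at_split:
  assumes "open_disc_series a" "ord_ge t x" "t > 0"
  shows "infsum (\<lambda>n. a (n + k) * x ^ n) UNIV = a k + x * infsum (\<lambda>n. a (n + Suc k) * x ^ n) UNIV"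
proof -
  have "infsum (\<lambda>n. a (n + k) * x ^ n) UNIV = a k + infsum (\<lambda>n. x * (a (n + Suc k) * x ^ n)) UNIV"
    by (subst infsum_null_Suc[OF series_null_family[OF assms]]) (simp add: mult_ac)
  then show ?thesis using infsum_null_cmult[OF series_null_family[OF assms, of "Suc k"]] by simp
qed

text \<open>
The quotient of \<open>f X - f z\<close> by \<open>X - z\<close> has the coefficients \<open>\<Sum>j. a (n + 1 + j) * z ^ j\<close>. Dividing lowers a
bound on the Gauss norm of the radius given by \<open>\<rho>\<close> by exactly \<open>\<rho>\<close>, since the coefficient of index \<open>n\<close> only involves
\<open>a k\<close> for \<open>k > n\<close>.
\<close>

lemma divide_linear:
  assumes a: "open_disc_series a" and z: "ord_ge \<rho> z" and \<rho>: "\<rho> > 0"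
  obtains g where "open_disc_series g"
    and "\<And>x t. ord_ge t x \<Longrightarrow> t > 0 \<Longrightarrow> series_at a x = series_at a z + (x - z) * series_at g x"
    and "\<forall>B. (\<forall>n. ord_ge (B - real n * \<rho>) (a n)) \<longrightarrow> (\<forall>n. ord_ge (B - \<rho> - real n * \<rho>) (g n))"
proof -
  define T where "T k = infsum (\<lambda>n. a (n + k) * z ^ n) UNIV" for k
  have T: "T k = a k + z * T (Suc k)" for k
    unfolding T_def by (rule series_at_split[OF a z \<rho>])
  have bound: "ord_ge (B - real k * t) (T k)"
    if B: "\<And>n. ord_ge (B - real n * t) (a n)" and t: "t \<le> \<rho>" for B t k
    unfolding T_def
  proof (rule infsum_ord_ge[OF series_null_family[OF a z \<rho>]])
    fix n
    show "ord_ge (B - real k * t) (a (n + k) * z ^ n)"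
      using ord_ge_mult[OF B[of "n + k"] ord_ge_power[OF ord_ge_mono[OF z t], of n]]
      by (simp add: algebra_simps)
  qed
  have Tdisc: "open_disc_series (\<lambda>k. T (k + i))" for i
    unfolding open_disc_series_def
  proof (intro allI impI)
    fix t :: real assume t: "t > 0"
    \<comment> \<open>\<open>bound\<close> only applies to radii that reach \<open>z\<close>, and a bound at a larger radius implies one at a smaller radius\<close>
    obtain B where B: "\<And>n. ord_ge (B - real n * min t \<rho>) (a n)"
      using a t \<rho> unfolding open_disc_series_def by (metis min_less_iff_conj)
    show "\<exists>B. \<forall>n. ord_ge (B - real n * t) (T (n + i))"
    proof (intro exI allI)
      fix n
      have "real n * min t \<rho> \<le> real n * t" by (intro mult_left_mono) auto
      then show "ord_ge (B - real i * min t \<rho> - real n * t) (T (n + i))"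
        by (intro ord_ge_mono[OF bound[OF B, of "n + i"]]) (auto simp: algebra_simps)
    qed
  qed
  show ?thesis
  proof (rule that[of "\<lambda>k. T (Suc k)"])
    show "open_disc_series (\<lambda>k. T (Suc k))" using Tdisc[of 1] by simp
    have "ord_ge (B - \<rho> - real n * \<rho>) (T (Suc n))"
      if "\<forall>n. ord_ge (B - real n * \<rho>) (a n)" for B n
      using bound[of B \<rho> "Suc n"] that by (simp add: algebra_simps)
    then show "\<forall>B. (\<forall>n. ord_ge (B - real n * \<rho>) (a n)) \<longrightarrow> (\<forall>n. ord_ge (B - \<rho> - real n * \<rho>) (T (Suc n)))"
      by blast
    show "series_at a x = series_at a z + (x - z) * series_at (\<lambda>k. T (Suc k)) x"
      if x: "ord_ge t x" "t > 0" for x t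
    proof -
      have n0: "null_family (\<lambda>n. T (n + 0) * x ^ n) UNIV"
        and n1: "null_family (\<lambda>n. T (n + 1) * x ^ n) UNIV"
        using series_null_family[OF Tdisc[of 0] x, of 0] series_null_family[OF Tdisc[of 1] x, of 0] by auto
      have "series_at a x = infsum (\<lambda>n. T (n + 0) * x ^ n - z * (T (n + 1) * x ^ n)) UNIV"
        unfolding series_at_def
      proof (rule infsum_cong)
        fix n
        have "a n = T n - z * T (Suc n)" using T[of n] by simp
        then have "a n * x ^ n = (T n - z * T (Suc n)) * x ^ n" by simp
        then show "a n * x ^ n = T (n + 0) * x ^ n - z * (T (n + 1) * x ^ n)"
          by (simp only: left_diff_distrib mult.assoc add_0_right Suc_eq_plus1)
      qed
      also have "\<dots> = infsum (\<lambda>n. T (n + 0) * x ^ n) UNIV - z * infsum (\<lambda>n. T (n + 1) * x ^ n) UNIV"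
        by (simp only: infsum_null_diff[OF n0 null_family_cmult[OF n1]] infsum_null_cmult[OF n1])
      also have "infsum (\<lambda>n. T (n + 0) * x ^ n) UNIV = T 0 + x * infsum (\<lambda>n. T (n + 1) * x ^ n) UNIV"
        using series_at_split[OF Tdisc[of 0] x, of 0] by simp
      also have "T 0 = series_at a z" by (simp add: T_def series_at_def)
      finally show ?thesis by (simp add: series_at_def algebra_simps)
    qed
  qed
qed

text \<open>
The ultrametric Schwarz lemma: dividing by \<open>x - z\<close> for all zeros \<open>z\<close> successively leaves a series with
the bound \<open>B - card Z * \<rho>\<close>. Since the zeros are distinct, the quotient keeps vanishing at the
remaining ones.
\<close>

lemma schwarz_lemma:
  assumes "finite Z" "open_disc_series a" "\<And>n. ord_ge (B - real n * \<rho>) (a n)" "\<rho> > 0"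
    and "\<And>z. z \<in> Z \<Longrightarrow> ord_ge \<rho> z" "\<And>z. z \<in> Z \<Longrightarrow> series_at a z = 0" "ord_ge \<rho> x"
  shows "\<exists>G. series_at a x = (\<Prod>z\<in>Z. x - z) * G \<and> ord_ge (B - real (card Z) * \<rho>) G"
  using assms
proof (induction Z arbitrary: a B rule: finite_induct)
  case empty
  have "ord_ge B (series_at a x)"
    unfolding series_at_def
  proof (rule infsum_ord_ge)
    show "null_family (\<lambda>n. a n * x ^ n) UNIV"
      using series_null_family[OF empty.prems(1) \<open>ord_ge \<rho> x\<close> \<open>\<rho> > 0\<close>, of 0] by simp
    show "ord_ge B (a n * x ^ n)" for n
      using ord_ge_mult[OF empty.prems(2)[of n] ord_ge_power[OF \<open>ord_ge \<rho> x\<close>, of n]] by simp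
  qed
  then show ?case by simp
next
  case (insert z Z)
  have z: "ord_ge \<rho> z" "series_at a z = 0" using insert.prems by auto
  obtain g where g: "open_disc_series g"
    "\<And>x t. ord_ge t x \<Longrightarrow> t > 0 \<Longrightarrow> series_at a x = series_at a z + (x - z) * series_at g x"
    "\<forall>B. (\<forall>n. ord_ge (B - real n * \<rho>) (a n)) \<longrightarrow> (\<forall>n. ord_ge (B - \<rho> - real n * \<rho>) (g n))"
    using divide_linear[OF insert.prems(1) z(1) \<open>\<rho> > 0\<close>] by metis
  have "series_at g y = 0" if "y \<in> Z" for y
  proof -
    have "y \<noteq> z" using insert.hyps that by blast
    moreover have "series_at a y = 0" "ord_ge \<rho> y" using insert.prems that by auto
    ultimately show ?thesis using g(2)[of \<rho> y] z(2) \<open>\<rho> > 0\<close> by simp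
  qed
  then obtain G where G: "series_at g x = (\<Prod>z\<in>Z. x - z) * G"
      "ord_ge (B - \<rho> - real (card Z) * \<rho>) G"
    using insert.IH[OF g(1), of "B - \<rho>"] g(3) insert.prems by auto
  have "series_at a x = (\<Prod>z\<in>insert z Z. x - z) * G"
    using g(2)[OF \<open>ord_ge \<rho> x\<close> \<open>\<rho> > 0\<close>] z(2) G(1) insert.hyps by (simp add: mult_ac)
  moreover have "ord_ge (B - real (card (insert z Z)) * \<rho>) G"
    using G(2) insert.hyps by (simp add: algebra_simps)
  ultimately show ?case by blast
qed

text \<open>
At \<open>x = p ^ r\<close> all terms but the constant one have an order that grows with \<open>r\<close>. The point \<open>0\<close> itself is
left out, since the series divided by \<open>x\<close> is only known to vanish elsewhere; this is what the induction in the next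
lemma needs.
\<close>

lemma constant_coeff_eq_zero:
  assumes "open_disc_series a"
    and "\<And>x. x \<noteq> 0 \<Longrightarrow> ord_ge 1 x \<Longrightarrow> series_at a x = 0"
  shows "a 0 = 0"
proof -
  obtain B where B: "\<And>n. ord_ge (B - real n * 1) (a n)"
    using assms(1) unfolding open_disc_series_def by (metis zero_less_one)
  have "ord_ge c (a 0)" for c
  proof -
    \<comment> \<open>for \<open>n \<ge> 1\<close> the term at \<open>p ^ r\<close> has order at least \<open>B + n * (r - 1) \<ge> c\<close>\<close>
    define r where "r = Suc (nat \<lceil>c - B\<rceil>)"
    let ?x = "of_nat p ^ r :: 'c"
    have x: "ord_ge (real r) ?x" using ord_ge_power[OF ord_ge_1_of_nat[of p], of r] by simp
    have x1: "ord_ge 1 ?x" using x by (rule ord_ge_mono) (simp add: r_def)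
    have nf: "null_family (\<lambda>n. a n * ?x ^ n) UNIV"
      using series_null_family[OF assms(1) x1, of 0] by simp
    have "series_at a ?x = 0"
      using assms(2)[of ?x] x1 prime_gt_0_nat[OF prime_p] by simp
    moreover have "ord_ge c (infsum (\<lambda>n. a n * ?x ^ n) UNIV - (\<Sum>n\<in>{0}. a n * ?x ^ n))"
    proof (rule infsum_approx[OF nf])
      fix n :: nat assume "n \<in> UNIV - {0}"
      then have n: "real n \<ge> 1" by simp
      have "ord_ge (B - real n * 1 + real n * real r) (a n * ?x ^ n)"
        by (rule ord_ge_mult[OF B ord_ge_power[OF x]])
      moreover have "c \<le> B - real n * 1 + real n * real r"
      proof -
        have "c - B \<le> real r - 1" unfolding r_def by linarith
        also have "\<dots> \<le> real n * (real r - 1)"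
          using n mult_right_mono[of 1 "real n" "real r - 1"] by (simp add: r_def)
        finally show ?thesis by (simp add: algebra_simps)
      qed
      ultimately show "ord_ge c (a n * ?x ^ n)" by (rule ord_ge_mono)
    qed auto
    ultimately show ?thesis by (simp add: series_at_def)
  qed
  then show ?thesis by (rule eq_zero_if_ord_ge)
qed

lemma identity_theorem:
  assumes "open_disc_series a"
    and "\<And>x. x \<noteq> 0 \<Longrightarrow> ord_ge 1 x \<Longrightarrow> series_at a x = 0"
  shows "a n = 0"
  using assms
proof (induction n arbitrary: a)
  case 0
  then show ?case by (rule constant_coeff_eq_zero)
next
  case (Suc n)
  have a0: "a 0 = 0" using Suc.prems by (rule constant_coeff_eq_zero)
  show ?case
  proof (rule Suc.IH)
    show "open_disc_series (\<lambda>n. a (Suc n))"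
      unfolding open_disc_series_def
    proof (intro allI impI)
      fix t :: real assume "t > 0"
      then obtain B where B: "\<And>n. ord_ge (B - real n * t) (a n)"
        using Suc.prems(1) unfolding open_disc_series_def by metis
      have "ord_ge (B - t - real n * t) (a (Suc n))" for n
        using B[of "Suc n"] by (simp add: algebra_simps)
      then show "\<exists>B. \<forall>n. ord_ge (B - real n * t) (a (Suc n))" by blast
    qed
    show "series_at (\<lambda>n. a (Suc n)) x = 0" if "x \<noteq> 0" "ord_ge 1 x" for x
      using series_at_split[OF Suc.prems(1) that(2), of 0] Suc.prems(2)[OF that] that a0
      by (simp add: series_at_def)
  qed
qed

end

section \<open>Logarithmic growth\<close>

text \<open>
The constant is uniform in \<open>j\<close> because \<open>j / 2 ^ j\<close> tends to \<open>0\<close>.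
\<close>

lemma linear_le_exponential: "\<exists>D\<ge>0. \<forall>j::nat. h * real j \<le> 2 ^ j / 2 + D"
proof -
  have "(\<lambda>j. 2 * h * (real j * (1 / 2) ^ j)) \<longlonglongrightarrow> 2 * h * 0"
    by (intro tendsto_mult tendsto_const powser_times_n_limit_0) simp
  then have "eventually (\<lambda>j. 2 * h * (real j * (1 / 2) ^ j) < 1) sequentially"
    by (intro order_tendstoD) auto
  then obtain J where J: "\<And>j. j \<ge> J \<Longrightarrow> 2 * h * (real j * (1 / 2) ^ j) < 1"
    unfolding eventually_sequentially by blast
  have "h * real j \<le> 2 ^ j / 2 + \<bar>h\<bar> * real J" for j
  proof (cases "j \<ge> J")
    case True
    have "2 * h * real j < 2 ^ j"
      using J[OF True] by (simp add: power_one_over field_simps)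
    moreover have "0 \<le> \<bar>h\<bar> * real J" by simp
    ultimately show ?thesis by linarith
  next
    case False
    have "h * real j \<le> \<bar>h\<bar> * real J"
      using False by (intro mult_mono) auto
    moreover have "(0 :: real) \<le> 2 ^ j / 2" by simp
    ultimately show ?thesis by linarith
  qed
  then show ?thesis by (intro exI[of _ "\<bar>h\<bar> * real J"]) auto
qed

lemma ell_le_imp_power_le:
  assumes "e < ell p n"
  shows "p ^ e \<le> n"
  using not_less_Least[of e "\<lambda>m. n < p ^ m"] assms by (simp add: ell_def)

text \<open>
The logarithmic growth condition seen at the radius given by \<open>1 / p ^ m\<close>: up to a constant, only
exponents \<open>n < p ^ m\<close> matter and they cost at most \<open>h * m\<close>. If \<open>ell p n\<close> exceeds \<open>m\<close> by some \<open>j > 0\<close>, then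
\<open>n / p ^ m \<ge> p ^ (j - 1)\<close>, which outweighs the additional \<open>h * j\<close>. That \<open>D\<close> does not depend on \<open>m\<close> is
essential.
\<close>

lemma ell_growth:
  assumes "p \<ge> 2" "h \<ge> 0"
  shows "\<exists>D. \<forall>m n. h * real (ell p n) \<le> real n / real (p ^ m) + h * real m + D"
proof -
  obtain D where D: "D \<ge> 0" "\<And>j::nat. h * real j \<le> 2 ^ j / 2 + D"
    using linear_le_exponential by metis
  have "h * real (ell p n) \<le> real n / real (p ^ m) + h * real m + D" for m n
  proof (cases "ell p n \<le> m")
    case True
    then have "h * real (ell p n) \<le> h * real m" using assms(2) by (intro mult_left_mono) auto
    moreover have "0 \<le> real n / real (p ^ m)" by simp
    ultimately show ?thesis using D(1) by linarith
  next
    case False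
    then obtain j where j: "ell p n = m + Suc j"
      by (metis add_Suc_right less_imp_Suc_add not_le)
    have "p ^ m * 2 ^ j \<le> p ^ m * p ^ j"
      using assms(1) by (intro mult_left_mono power_mono) auto
    also have "\<dots> \<le> n"
      using ell_le_imp_power_le[of "m + j" p n] j by (simp add: power_add)
    finally have "real (p ^ m * 2 ^ j) \<le> real n" by (rule of_nat_mono)
    then have "real (p ^ m) * 2 ^ j \<le> real n" by simp
    moreover have "real (p ^ m) > 0" using assms(1) by simp
    ultimately have "2 ^ Suc j / 2 \<le> real n / real (p ^ m)"
      by (simp add: field_simps)
    moreover have "h * real (ell p n) = h * real m + h * real (Suc j)"
      by (simp add: j algebra_simps)
    ultimately show ?thesis using D(2)[of "Suc j"] by linarith
  qed
  then show ?thesis by blast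
qed

lemma inverse_power_le:
  assumes "p \<ge> 2" "t > 0"
  shows "\<exists>m. 1 / real (p ^ m) \<le> t"
proof -
  define m where "m = nat \<lceil>1 / t\<rceil>"
  have "1 / t \<le> real m" unfolding m_def by linarith
  also have "m \<le> 2 ^ m" by (simp add: less_imp_le)
  finally have "1 / t \<le> 2 ^ m" by simp
  also have "(2 :: real) ^ m \<le> real (p ^ m)"
    using assms(1) by (simp add: power_mono)
  finally have "1 / t \<le> real (p ^ m)" .
  then have "1 / real (p ^ m) \<le> t"
    using assms by (simp add: field_simps)
  then show ?thesis ..
qed

section \<open>Exponent vectors\<close>

definition agree_off :: "'k set \<Rightarrow> nat ^ 'k \<Rightarrow> (nat ^ 'k::finite) set" where
  "agree_off S m = {n. \<forall>i. i \<notin> S \<longrightarrow> n $ i = m $ i}"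

definition vec_upd :: "'a ^ 'k \<Rightarrow> 'k \<Rightarrow> 'a \<Rightarrow> 'a ^ 'k::finite" where
  "vec_upd x j y = (\<chi> i. if i = j then y else x $ i)"

lemma vec_upd_nth [simp]: "vec_upd x j y $ i = (if i = j then y else x $ i)"
  by (simp add: vec_upd_def)

lemma vec_upd_same: "vec_upd x j (x $ j) = x"
  by (simp add: vec_eq_iff)

lemma finite_agree_off:
  "finite {n \<in> agree_off S m. (\<Sum>i\<in>S. n $ i) \<le> r}"
proof -
  define R where "R = r + (\<Sum>i\<in>UNIV. m $ i)"
  have "finite ((\<lambda>g. \<chi> i. g i) ` (UNIV \<rightarrow>\<^sub>E {..R}) :: (nat ^ 'a) set)"
    by (intro finite_imageI finite_PiE) auto
  moreover have "{n \<in> agree_off S m. (\<Sum>i\<in>S. n $ i) \<le> r} \<subseteq> (\<lambda>g. \<chi> i. g i) ` (UNIV \<rightarrow>\<^sub>E {..R})"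
  proof
    fix n assume n: "n \<in> {n \<in> agree_off S m. (\<Sum>i\<in>S. n $ i) \<le> r}"
    have "n $ i \<le> R" for i
    proof (cases "i \<in> S")
      case True
      then have "n $ i \<le> (\<Sum>i\<in>S. n $ i)" by (intro member_le_sum) auto
      then show ?thesis using n by (simp add: R_def)
    next
      case False
      then have "n $ i = m $ i" using n by (simp add: agree_off_def)
      also have "\<dots> \<le> (\<Sum>i\<in>UNIV. m $ i)" by (intro member_le_sum) auto
      finally show ?thesis by (simp add: R_def)
    qed
    then show "n \<in> (\<lambda>g. \<chi> i. g i) ` (UNIV \<rightarrow>\<^sub>E {..R})"
      by (intro image_eqI[of _ _ "\<lambda>i. n $ i"]) (auto simp: vec_eq_iff)
  qed
  ultimately show ?thesis by (rule finite_subset[rotated])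
qed

section \<open>Uniqueness in one variable\<close>

context padic_complex_field
begin

lemma p_ge_2: "p \<ge> 2"
  using prime_ge_2_nat[OF prime_p] .

text \<open>
Negative exponents require \<open>ord (inverse w) \<ge> 0\<close>, that is, \<open>ord w \<le> 0\<close>: otherwise \<open>1 = w - (w - 1)\<close> would have
positive order.
\<close>

lemma ord_ge_powi_minus_one:
  assumes "ord_ge 1 (w - 1)"
  shows "w \<noteq> 0" "ord_ge 1 (w powi i - 1)"
proof -
  show w0: "w \<noteq> 0" using assms by (metis diff_0 not_one_le_zero ord_ge_minus ord_ge_one)
  obtain s where s: "ord w = ereal s" using ord_nonzero_real[OF w0] by blast
  have "s \<le> 0"
  proof (rule ccontr)
    assume "\<not> s \<le> 0"
    have "ord_ge s w" using s by (simp add: ord_ge_def)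
    then have "ord_ge (min s 1) w" by (rule ord_ge_mono) simp
    moreover have "ord_ge (min s 1) (w - 1)" using assms by (rule ord_ge_mono) simp
    ultimately have "ord_ge (min s 1) (w - (w - 1))" by (rule ord_ge_diff)
    then have "min s 1 \<le> 0" by simp
    then show False using \<open>\<not> s \<le> 0\<close> by linarith
  qed
  moreover have "ord w + ord (inverse w) = 0"
    using ord_mult[of w "inverse w"] w0 ord_one by simp
  ultimately have inv: "ord_ge 0 (inverse w)"
    using s by (cases "ord (inverse w)") (auto simp: ord_ge_def zero_ereal_def)
  have pow: "ord_ge 1 (v ^ n - 1)" if "ord_ge 1 (v - 1)" for v n
    using power_cong_mod_p[OF that, of n] by simp
  have "ord_ge (1 + 0) (- ((w - 1) * inverse w))"
    unfolding ord_ge_minus by (rule ord_ge_mult[OF assms inv])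
  moreover have "- ((w - 1) * inverse w) = inverse w - 1" using w0 by (simp add: algebra_simps)
  ultimately have "ord_ge 1 (inverse w - 1)" by simp
  then show "ord_ge 1 (w powi i - 1)"
    using pow[OF assms] pow[of "inverse w"] by (simp add: power_int_def)
qed

text \<open>
The prescribed zeros of level \<open>m\<close> lie in the disc on which the Schwarz lemma is applied.
\<close>

lemma ord_ge_zero_point:
  assumes "ord_ge 1 (w - 1)" "\<epsilon> ^ (p ^ m) = 1"
  shows "ord_ge (1 / real (p ^ m)) (w powi i * \<epsilon> - 1)"
proof (rule ord_ge_minus_one_of_power)
  have w: "ord_ge 1 (w powi i - 1)" by (rule ord_ge_powi_minus_one[OF assms(1)])
  have "ord_ge 0 ((w powi i - 1) + 1)" by (intro ord_ge_add) (auto intro: ord_ge_mono[OF w])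
  moreover have "ord_ge 0 \<epsilon>"
    using ord_ge_root[of 0 \<epsilon> "p ^ m"] assms(2) prime_gt_0_nat[OF prime_p] by simp
  ultimately show "ord_ge 0 (w powi i * \<epsilon>)" using ord_ge_mult[of 0 _ 0] by fastforce
  show "ord_ge 1 ((w powi i * \<epsilon>) ^ p ^ m - 1)"
    using power_cong_mod_p[OF w, of "p ^ m"] assms(2) by (simp add: power_mult_distrib)
qed

lemma powi_power_inj:
  fixes w :: 'c
  assumes "w \<noteq> 0" "\<And>n. n > 0 \<Longrightarrow> w ^ n \<noteq> 1" "q > 0" "(w powi i) ^ q = (w powi j) ^ q"
  shows "i = j"
proof -
  have False if "i < j" "(w powi i) ^ q = (w powi j) ^ q" for i j
  proof -
    have "w powi j = w powi i * w ^ nat (j - i)"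
      using power_int_add[of w i "j - i"] assms(1) that by (simp add: power_int_def)
    then have "(w powi i) ^ q * w ^ (nat (j - i) * q) = (w powi i) ^ q * 1"
      using that by (simp add: power_mult power_mult_distrib)
    then have "w ^ (nat (j - i) * q) = 1" using assms(1) by simp
    then show False using assms(2,3) that(1) by simp
  qed
  then show ?thesis using assms(4) by (metis linorder_neqE)
qed

text \<open>
The zeros of level \<open>m\<close> are distinct because the \<open>p ^ m\<close>-th power of \<open>w powi i * \<epsilon>\<close> determines \<open>i\<close> when \<open>w\<close> is not a
root of unity. Grouping them by \<open>i\<close> evaluates their product in closed form, which makes its order
accessible.
\<close>

lemma prod_zeros:
  assumes "ord_ge 1 (w - 1)" "\<And>n. n > 0 \<Longrightarrow> w ^ n \<noteq> 1" "finite I"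
    and Z: "Z = (\<lambda>(i, \<epsilon>). w powi i * \<epsilon> - 1) ` (I \<times> {\<epsilon>. \<epsilon> ^ (p ^ m) = 1})"
  shows "finite Z" "card Z = card I * p ^ m"
    and "(\<Prod>z\<in>Z. x - z) = (\<Prod>i\<in>I. (1 + x) ^ (p ^ m) - (w powi i) ^ (p ^ m))"
proof -
  let ?q = "p ^ m" and ?M = "{\<epsilon> :: 'c. \<epsilon> ^ (p ^ m) = 1}"
  have q: "?q > 0" using prime_gt_0_nat[OF prime_p] by simp
  have w0: "w \<noteq> 0" using ord_ge_powi_minus_one[OF assms(1)] by blast
  have fM: "finite ?M" using card_roots_of_unity[of m] q by (metis card.infinite less_irrefl)
  have inj: "inj_on (\<lambda>(i, \<epsilon>). w powi i * \<epsilon> - 1) (I \<times> ?M)"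
  proof (rule inj_onI, clarify)
    fix i j and \<epsilon> \<delta> :: 'c
    assume *: "\<epsilon> ^ ?q = 1" "\<delta> ^ ?q = 1" "w powi i * \<epsilon> - 1 = w powi j * \<delta> - 1"
    then have "(w powi i * \<epsilon>) ^ ?q = (w powi j * \<delta>) ^ ?q" by simp
    then have "(w powi i) ^ ?q = (w powi j) ^ ?q" using * by (simp add: power_mult_distrib)
    then have "i = j" using powi_power_inj[OF w0 assms(2) q] by blast
    then show "i = j \<and> \<epsilon> = \<delta>" using * w0 by simp
  qed
  show "finite Z" using assms(3) fM Z by simp
  show "card Z = card I * ?q"
    unfolding Z card_image[OF inj] card_cartesian_product card_roots_of_unity ..
  have "(\<Prod>z\<in>Z. x - z) = (\<Prod>(i, \<epsilon>)\<in>I \<times> ?M. (1 + x) - w powi i * \<epsilon>)"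
    unfolding Z prod.reindex[OF inj] by (intro prod.cong) auto
  also have "\<dots> = (\<Prod>i\<in>I. \<Prod>\<epsilon>\<in>?M. (1 + x) - w powi i * \<epsilon>)"
    by (rule prod.cartesian_product[symmetric])
  also have "\<dots> = (\<Prod>i\<in>I. (1 + x) ^ ?q - (w powi i) ^ ?q)"
    using w0 by (intro prod.cong refl prod_roots_of_unity[OF card_roots_of_unity q]) simp
  finally show "(\<Prod>z\<in>Z. x - z) = (\<Prod>i\<in>I. (1 + x) ^ ?q - (w powi i) ^ ?q)" .
qed

text \<open>
The one-variable case of the theorem. The comparison of growth with the number of zeros happens in the
inequality \<open>key\<close>, where the Schwarz lemma loses \<open>h * m\<close> and the product over the zeros gains \<open>N * m\<close>.
\<close>

lemma one_variable_uniqueness: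
  assumes h: "h \<ge> 0" and growth: "\<And>n. ord_ge (C - h * real (ell p n)) (a n)"
    and w: "ord_ge 1 (w - 1)" "\<And>n. n > 0 \<Longrightarrow> w ^ n \<noteq> 1"
    and vanish: "\<And>i \<epsilon>. i \<in> {d..d + \<lfloor>h\<rfloor>} \<Longrightarrow> \<epsilon> \<in> mu_p_infinity p \<Longrightarrow> series_at a (w powi i * \<epsilon> - 1) = 0"
  shows "a n = 0"
proof -
  obtain D where D: "\<And>m n. h * real (ell p n) \<le> real n / real (p ^ m) + h * real m + D"
    using ell_growth[OF p_ge_2 h] by metis
  have bound: "ord_ge (C - h * real m - D - real n * (1 / real (p ^ m))) (a n)" for m n
    by (rule ord_ge_mono[OF growth]) (use D[of n m] in simp)
  have disc: "open_disc_series a"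
    unfolding open_disc_series_def
  proof (intro allI impI)
    fix t :: real assume "t > 0"
    then obtain m where m: "1 / real (p ^ m) \<le> t" using inverse_power_le[OF p_ge_2] by blast
    have "ord_ge (C - h * real m - D - real n * t) (a n)" for n
      by (rule ord_ge_mono[OF bound[of m n]]) (use mult_left_mono[OF m, of "real n"] in simp)
    then show "\<exists>B. \<forall>n. ord_ge (B - real n * t) (a n)" by blast
  qed
  define I where "I = {d..d + \<lfloor>h\<rfloor>}"
  define N where "N = real (card I)"
  have N: "N > h"
  proof -
    have "N = of_int (\<lfloor>h\<rfloor> + 1)" using h by (simp add: N_def I_def)
    then show ?thesis by linarith
  qed
  have key: "ord_ge (C - D + (N - h) * real m) (series_at a x)" if x: "ord_ge 1 x" for x m
  proof -
    let ?q = "p ^ m" and ?\<rho> = "1 / real (p ^ m)"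
    define Z where "Z = (\<lambda>(i, \<epsilon>). w powi i * \<epsilon> - 1) ` (I \<times> {\<epsilon>. \<epsilon> ^ (p ^ m) = 1})"
    have "finite I" by (simp add: I_def)
    note Zf = prod_zeros[OF w this Z_def]
    have q: "real ?q \<ge> 1" using p_ge_2 by simp
    have \<rho>: "?\<rho> > 0" using p_ge_2 by simp
    have \<rho>1: "?\<rho> \<le> 1" using q unfolding divide_le_eq_1 by linarith
    have "\<exists>G. series_at a x = (\<Prod>z\<in>Z. x - z) * G \<and> ord_ge (C - h * real m - D - real (card Z) * ?\<rho>) G"
    proof (rule schwarz_lemma[OF Zf(1) disc bound \<rho>])
      show "ord_ge ?\<rho> z" if "z \<in> Z" for z
        using that ord_ge_zero_point[OF w(1)] by (auto simp: Z_def)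
      show "series_at a z = 0" if "z \<in> Z" for z
      proof -
        obtain i \<epsilon> where "z = w powi i * \<epsilon> - 1" "i \<in> I" "\<epsilon> ^ ?q = 1"
          using \<open>z \<in> Z\<close> by (auto simp: Z_def)
        then show ?thesis using vanish[of i \<epsilon>] by (auto simp: I_def mu_p_infinity_def)
      qed
      show "ord_ge ?\<rho> x" using x \<rho>1 by (rule ord_ge_mono)
    qed
    then obtain G where G: "series_at a x = (\<Prod>z\<in>Z. x - z) * G"
      "ord_ge (C - h * real m - D - real (card Z) * ?\<rho>) G" by blast
    have "real (card Z) = N * real ?q" by (simp add: Zf(2) N_def)
    then have "real (card Z) * ?\<rho> = N" using p_ge_2 by simp
    note G2 = G(2)[unfolded this]
    have "ord_ge (real m + 1) ((1 + x) ^ ?q - (w powi i) ^ ?q)" for i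
    proof -
      have "ord_ge (real m + 1) ((1 + x) ^ ?q - 1)"
        by (rule ord_ge_power_p_minus_one) (use x in simp)
      moreover have "ord_ge (real m + 1) ((w powi i) ^ ?q - 1)"
        by (intro ord_ge_power_p_minus_one ord_ge_powi_minus_one(2) w(1))
      ultimately show ?thesis using ord_ge_diff by fastforce
    qed
    then have "ord_ge (\<Sum>i\<in>I. real m + 1) (\<Prod>i\<in>I. (1 + x) ^ ?q - (w powi i) ^ ?q)"
      by (intro ord_ge_prod)
    also have "(\<Prod>i\<in>I. (1 + x) ^ ?q - (w powi i) ^ ?q) = (\<Prod>z\<in>Z. x - z)"
      by (rule Zf(3)[symmetric])
    finally have "ord_ge (N * (real m + 1)) (\<Prod>z\<in>Z. x - z)" by (simp add: N_def)
    from ord_ge_mult[OF this G2] show ?thesis unfolding G(1)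
      by (rule ord_ge_mono) (simp add: algebra_simps)
  qed
  have "series_at a x = 0" if x: "ord_ge 1 x" for x
  proof (rule eq_zero_if_ord_ge)
    fix c
    \<comment> \<open>a level at which the bound of \<open>key\<close> exceeds \<open>c\<close>\<close>
    define m where "m = nat \<lceil>(c - (C - D)) / (N - h)\<rceil>"
    have "(c - (C - D)) / (N - h) \<le> real m" unfolding m_def by linarith
    then have "c \<le> C - D + (N - h) * real m" using N by (simp add: field_simps)
    with key[OF x] show "ord_ge c (series_at a x)" by (rule ord_ge_mono)
  qed
  then show ?thesis using identity_theorem[OF disc] by blast
qed

text \<open>
The powers of a root of unity form a finite set, which is already closed, whereas \<open>1 + 2 p \<int>\<^sub>p\<close> contains
\<open>1 + 2 p k\<close> for all natural numbers \<open>k\<close>.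
\<close>

lemma topological_generator_facts:
  assumes "topological_generator (one_plus_2p_Zp p ord) u"
  shows "ord_ge 1 (u - 1)" "n > 0 \<Longrightarrow> u ^ n \<noteq> 1"
proof -
  let ?G = "one_plus_2p_Zp p ord"
  have uG: "u \<in> ?G" and cl: "closure (range (\<lambda>n::int. u powi n)) = ?G"
    using assms by (auto simp: topological_generator_def)
  obtain z where z: "u = 1 + 2 * of_nat p * z" "ord_ge 0 z"
    using uG by (auto simp: one_plus_2p_Zp_def Zp_def valuation_ring_def ord_ge_def zero_ereal_def)
  have "ord_ge (1 + 0) (of_nat (2 * p) * z)"
    by (intro ord_ge_mult ord_ge_1_of_nat z(2)) simp
  then show u1: "ord_ge 1 (u - 1)" using z(1) by simp
  show "u ^ n \<noteq> 1" if n: "n > 0"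
  proof
    assume un: "u ^ n = 1"
    have u0: "u \<noteq> 0" using ord_ge_powi_minus_one[OF u1] by blast
    have "u powi i \<in> (\<lambda>k. u ^ k) ` {..<n}" for i :: int
    proof -
      have "u powi i = u powi (int n * (i div int n) + i mod int n)" by simp
      also have "\<dots> = (u powi int n) powi (i div int n) * u powi (i mod int n)"
        using u0 by (simp only: power_int_add power_int_mult simp_thms)
      also have "\<dots> = u ^ nat (i mod int n)" using un n by (simp add: power_int_def)
      finally show ?thesis using n by (auto simp: nat_less_iff)
    qed
    then have "range (\<lambda>i::int. u powi i) \<subseteq> (\<lambda>k. u ^ k) ` {..<n}" by blast
    then have "finite (range (\<lambda>i::int. u powi i))" by (rule finite_subset) simp
    then have "finite ?G" using cl finite_imp_closed[of "range (\<lambda>i::int. u powi i)"]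
      by (simp only: closure_closed)
    moreover have "range (\<lambda>k::nat. 1 + 2 * of_nat p * of_nat k) \<subseteq> ?G"
    proof safe
      fix k :: nat
      have "(of_nat k :: 'c) \<in> Qp" unfolding Qp_def using closure_subset by (metis Rats_of_nat subsetD)
      moreover have "ord (of_nat k) \<ge> 0" using ord_ge_of_nat[of k] by (simp add: ord_ge_def zero_ereal_def)
      ultimately show "1 + 2 * of_nat p * of_nat k \<in> ?G"
        by (auto simp: one_plus_2p_Zp_def Zp_def valuation_ring_def)
    qed
    moreover have "inj (\<lambda>k::nat. 1 + 2 * of_nat p * of_nat k :: 'c)"
      using prime_gt_0_nat[OF prime_p] by (auto simp: inj_on_def)
    ultimately show False by (meson finite_subset range_inj_infinite)
  qed
qed

section \<open>Removing variables one at a time\<close>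

text \<open>
Evaluation in the variables of \<open>S\<close> only: this is the coefficient of \<open>\<Prod>i\<in>-S. X i ^ (m $ i)\<close> in \<open>f\<close>, regarded as a power
series in the variables outside \<open>S\<close>, at the point \<open>x\<close>. Its value depends on \<open>m\<close> only outside \<open>S\<close> and on \<open>x\<close> only
inside \<open>S\<close>.
\<close>

definition partial_eval :: "(nat ^ 'k::finite \<Rightarrow> 'c) \<Rightarrow> 'k set \<Rightarrow> nat ^ 'k \<Rightarrow> 'c ^ 'k \<Rightarrow> 'c" where
  "partial_eval f S m x = infsum (\<lambda>n. f n * (\<Prod>i\<in>S. (x $ i) ^ (n $ i))) (agree_off S m)"

text \<open>
Each evaluated variable contributes order \<open>t * n\<close>, half of which absorbs the growth \<open>h * ell p n\<close>. The
remaining half gives summability, and the growth in the variables outside \<open>S\<close> is left untouched.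
\<close>

lemma partial_eval_term_bound:
  fixes f :: "nat ^ 'k::finite \<Rightarrow> 'c" and h :: "real ^ 'k" and x :: "'c ^ 'k"
  assumes growth: "\<And>n. ord_ge (C - h \<bullet> ell_vec p n) (f n)" and h: "\<And>i. h $ i \<ge> 0"
    and x: "\<And>i. ord_ge t (x $ i)" and t: "t > 0"
  shows "\<exists>D. \<forall>n. ord_ge (C - D - (\<Sum>i\<in>-S. h $ i * real (ell p (n $ i))) + t / 2 * real (\<Sum>i\<in>S. n $ i))
           (f n * (\<Prod>i\<in>S. (x $ i) ^ (n $ i)))"
proof -
  have "\<exists>D. \<forall>n. h $ i * real (ell p n) \<le> t / 2 * real n + D" for i
  proof -
    obtain m where m: "1 / real (p ^ m) \<le> t / 2" using inverse_power_le[OF p_ge_2, of "t / 2"] t by auto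
    obtain D where D: "\<And>m n. h $ i * real (ell p n) \<le> real n / real (p ^ m) + h $ i * real m + D"
      using ell_growth[OF p_ge_2 h] by metis
    have "h $ i * real (ell p n) \<le> t / 2 * real n + (h $ i * real m + D)" for n
    proof -
      have "real n / real (p ^ m) = 1 / real (p ^ m) * real n" by simp
      also have "\<dots> \<le> t / 2 * real n" by (rule mult_right_mono[OF m]) simp
      finally show ?thesis using D[of n m] by linarith
    qed
    then show ?thesis by blast
  qed
  then obtain D where D: "\<And>i n. h $ i * real (ell p n) \<le> t / 2 * real n + D i" by metis
  have "ord_ge (C - sum D S - (\<Sum>i\<in>-S. h $ i * real (ell p (n $ i))) + t / 2 * real (\<Sum>i\<in>S. n $ i))
           (f n * (\<Prod>i\<in>S. (x $ i) ^ (n $ i)))" for n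
  proof (rule ord_ge_mono)
    have "ord_ge (\<Sum>i\<in>S. real (n $ i) * t) (\<Prod>i\<in>S. (x $ i) ^ (n $ i))"
      by (intro ord_ge_prod ord_ge_power x)
    from ord_ge_mult[OF growth this]
    show "ord_ge (C - h \<bullet> ell_vec p n + (\<Sum>i\<in>S. real (n $ i) * t)) (f n * (\<Prod>i\<in>S. (x $ i) ^ (n $ i)))" .
    have "h \<bullet> ell_vec p n = (\<Sum>i\<in>UNIV. h $ i * real (ell p (n $ i)))"
      by (simp add: inner_vec_def ell_vec_def)
    also have "\<dots> = (\<Sum>i\<in>S. h $ i * real (ell p (n $ i))) + (\<Sum>i\<in>-S. h $ i * real (ell p (n $ i)))"
      by (subst sum.union_disjoint[symmetric]) (auto simp: Compl_partition)
    also have "(\<Sum>i\<in>S. h $ i * real (ell p (n $ i))) \<le> (\<Sum>i\<in>S. t / 2 * real (n $ i) + D i)"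
      by (intro sum_mono D)
    also have "\<dots> = t / 2 * real (\<Sum>i\<in>S. n $ i) + sum D S"
      by (simp add: sum.distrib sum_distrib_left)
    finally have *: "h \<bullet> ell_vec p n \<le> t / 2 * real (\<Sum>i\<in>S. n $ i) + sum D S
        + (\<Sum>i\<in>-S. h $ i * real (ell p (n $ i)))" by simp
    have "(\<Sum>i\<in>S. real (n $ i) * t) = t * real (\<Sum>i\<in>S. n $ i)"
      by (simp add: sum_distrib_left mult.commute)
    with * show "C - sum D S - (\<Sum>i\<in>-S. h $ i * real (ell p (n $ i))) + t / 2 * real (\<Sum>i\<in>S. n $ i)
        \<le> C - h \<bullet> ell_vec p n + (\<Sum>i\<in>S. real (n $ i) * t)"
      by (simp add: algebra_simps)
  qed
  then show ?thesis by blast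
qed

lemma partial_eval_null_family:
  fixes f :: "nat ^ 'k::finite \<Rightarrow> 'c" and h :: "real ^ 'k" and x :: "'c ^ 'k"
  assumes growth: "\<And>n. ord_ge (C - h \<bullet> ell_vec p n) (f n)" and h: "\<And>i. h $ i \<ge> 0"
    and x: "\<And>i. ord_ge t (x $ i)" and t: "t > 0"
  shows "null_family (\<lambda>n. f n * (\<Prod>i\<in>S. (x $ i) ^ (n $ i))) (agree_off S m)"
proof -
  obtain D where D: "\<And>n. ord_ge (C - D - (\<Sum>i\<in>-S. h $ i * real (ell p (n $ i))) + t / 2 * real (\<Sum>i\<in>S. n $ i))
           (f n * (\<Prod>i\<in>S. (x $ i) ^ (n $ i)))"
    using partial_eval_term_bound[where S = S, OF growth h x t] by blast
  show ?thesis
  proof (rule null_familyI[where s = "\<lambda>n. \<Sum>i\<in>S. n $ i" and c = "t / 2"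
        and b = "C - D - (\<Sum>i\<in>-S. h $ i * real (ell p (m $ i)))"])
    fix n assume "n \<in> agree_off S m"
    then have "(\<Sum>i\<in>-S. h $ i * real (ell p (n $ i))) = (\<Sum>i\<in>-S. h $ i * real (ell p (m $ i)))"
      by (intro sum.cong) (auto simp: agree_off_def)
    then show "ord_ge (C - D - (\<Sum>i\<in>-S. h $ i * real (ell p (m $ i))) + t / 2 * real (\<Sum>i\<in>S. n $ i))
           (f n * (\<Prod>i\<in>S. (x $ i) ^ (n $ i)))" using D[of n] by simp
  qed (use t finite_agree_off in auto)
qed

text \<open>
The coefficients obtained by evaluating some variables still satisfy the growth condition in the
other variables, with a constant independent of the exponents \<open>m\<close>.
\<close>

lemma partial_eval_bound:
  fixes f :: "nat ^ 'k::finite \<Rightarrow> 'c" and h :: "real ^ 'k" and x :: "'c ^ 'k"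
  assumes growth: "\<And>n. ord_ge (C - h \<bullet> ell_vec p n) (f n)" and h: "\<And>i. h $ i \<ge> 0"
    and x: "\<And>i. ord_ge t (x $ i)" and t: "t > 0"
  shows "\<exists>D. \<forall>m. ord_ge (D - (\<Sum>i\<in>-S. h $ i * real (ell p (m $ i)))) (partial_eval f S m x)"
proof -
  obtain D where D: "\<And>n. ord_ge (C - D - (\<Sum>i\<in>-S. h $ i * real (ell p (n $ i))) + t / 2 * real (\<Sum>i\<in>S. n $ i))
           (f n * (\<Prod>i\<in>S. (x $ i) ^ (n $ i)))"
    using partial_eval_term_bound[where S = S, OF growth h x t] by blast
  have "ord_ge (C - D - (\<Sum>i\<in>-S. h $ i * real (ell p (m $ i)))) (partial_eval f S m x)" for m
    unfolding partial_eval_def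
  proof (rule infsum_ord_ge[OF partial_eval_null_family[OF growth h x t]])
    fix n assume "n \<in> agree_off S m"
    then have "(\<Sum>i\<in>-S. h $ i * real (ell p (n $ i))) = (\<Sum>i\<in>-S. h $ i * real (ell p (m $ i)))"
      by (intro sum.cong) (auto simp: agree_off_def)
    moreover have "0 \<le> t / 2 * real (\<Sum>i\<in>S. n $ i)"
      using t by (intro mult_nonneg_nonneg of_nat_0_le_iff) simp
    ultimately show "ord_ge (C - D - (\<Sum>i\<in>-S. h $ i * real (ell p (m $ i))))
           (f n * (\<Prod>i\<in>S. (x $ i) ^ (n $ i)))"
      by (intro ord_ge_mono[OF D[of n]]) linarith
  qed
  then show ?thesis by blast
qed

text \<open>
Summation by blocks according to the exponent of the variable \<open>j\<close>.
\<close>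

lemma partial_eval_insert:
  fixes f :: "nat ^ 'k::finite \<Rightarrow> 'c" and h :: "real ^ 'k" and x :: "'c ^ 'k"
  assumes growth: "\<And>n. ord_ge (C - h \<bullet> ell_vec p n) (f n)" and h: "\<And>i. h $ i \<ge> 0"
    and x: "\<And>i. ord_ge t (x $ i)" and t: "t > 0" and j: "j \<notin> S"
  shows "partial_eval f (insert j S) m x = series_at (\<lambda>l. partial_eval f S (vec_upd m j l) x) (x $ j)"
proof -
  let ?A = "\<lambda>l. agree_off S (vec_upd m j l)"
  let ?F = "\<lambda>n. f n * (\<Prod>i\<in>insert j S. (x $ i) ^ (n $ i))"
  have U: "agree_off (insert j S) m = (\<Union>l\<in>UNIV. ?A l)"
    using j by (auto simp: agree_off_def)
  have disj: "disjoint_family_on ?A UNIV"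
    using j by (fastforce simp: disjoint_family_on_def agree_off_def)
  have null: "null_family ?F (\<Union>l\<in>UNIV. ?A l)"
    unfolding U[symmetric] by (rule partial_eval_null_family[OF growth h x t])
  have "infsum ?F (?A l) = partial_eval f S (vec_upd m j l) x * (x $ j) ^ l" for l
  proof -
    have "infsum ?F (?A l) = infsum (\<lambda>n. (x $ j) ^ l * (f n * (\<Prod>i\<in>S. (x $ i) ^ (n $ i)))) (?A l)"
    proof (rule infsum_cong)
      fix n assume "n \<in> ?A l"
      then have "n $ j = l" using j by (auto simp: agree_off_def)
      then show "?F n = (x $ j) ^ l * (f n * (\<Prod>i\<in>S. (x $ i) ^ (n $ i)))"
        using j by (simp add: mult_ac)
    qed
    also have "\<dots> = (x $ j) ^ l * partial_eval f S (vec_upd m j l) x"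
      unfolding partial_eval_def by (rule infsum_null_cmult[OF partial_eval_null_family[OF growth h x t]])
    finally show ?thesis by (simp add: mult.commute)
  qed
  then show ?thesis
    unfolding series_at_def partial_eval_def[of f "insert j S"] U infsum_null_Union(2)[OF null disj]
    by simp
qed

lemma partial_eval_empty: "partial_eval f {} m x = f m"
proof -
  have A: "agree_off {} m = {m}" by (auto simp: agree_off_def vec_eq_iff)
  have "ord_ge c (infsum f {m} - sum f {m})" for c
    by (rule infsum_approx) (auto simp: null_family_def)
  then have "infsum f {m} - sum f {m} = 0" by (rule eq_zero_if_ord_ge)
  then show ?thesis by (simp add: partial_eval_def A)
qed

lemma partial_eval_UNIV: "partial_eval f UNIV m x = mpowser_eval f x"
  by (simp add: partial_eval_def mpowser_eval_def monomial_at_def agree_off_def)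

lemma partial_eval_cong:
  fixes x y :: "'c ^ 'k::finite"
  shows "(\<And>i. i \<in> S \<Longrightarrow> x $ i = y $ i) \<Longrightarrow> partial_eval f S m x = partial_eval f S m y"
  unfolding partial_eval_def by (intro infsum_cong arg_cong2[where f = "(*)"] prod.cong refl) auto

definition grid :: "real \<Rightarrow> int \<Rightarrow> 'c \<Rightarrow> 'c set" where
  "grid h d w = {w powi i * \<epsilon> - 1 | i \<epsilon>. i \<in> {d..d + \<lfloor>h\<rfloor>} \<and> \<epsilon> \<in> mu_p_infinity p}"

lemma grid_ord_pos:
  assumes "ord_ge 1 (w - 1)" "y \<in> grid h d w"
  shows "\<exists>t>0. ord_ge t y"
proof -
  obtain i \<epsilon> m where y: "y = w powi i * \<epsilon> - 1" "\<epsilon> ^ (p ^ m) = 1"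
    using assms(2) by (auto simp: grid_def mu_p_infinity_def)
  have "1 / real (p ^ m) > 0" using p_ge_2 by simp
  then show ?thesis using ord_ge_zero_point[OF assms(1) y(2)] y(1) by blast
qed

text \<open>
The set \<open>R\<close> of variables that have been stripped off grows during the induction. Passing from \<open>R\<close> to
\<open>insert j R\<close> applies the one-variable theorem to the series in the \<open>j\<close>-th variable whose coefficients are the
partial evaluations in the remaining variables.
\<close>

lemma several_variables_uniqueness:
  fixes f :: "nat ^ 'k::finite \<Rightarrow> 'c" and h :: "real ^ 'k" and d :: "int ^ 'k" and w :: "'c ^ 'k"
  assumes growth: "\<And>n. ord_ge (C - h \<bullet> ell_vec p n) (f n)" and h: "\<And>i. h $ i \<ge> 0"
    and w: "\<And>j. ord_ge 1 (w $ j - 1)" "\<And>j n. n > 0 \<Longrightarrow> (w $ j) ^ n \<noteq> 1"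
    and vanish: "\<And>x :: 'c ^ 'k. (\<And>j. x $ j \<in> grid (h $ j) (d $ j) (w $ j)) \<Longrightarrow> mpowser_eval f x = 0"
  shows "f m = 0"
proof -
  let ?grid = "\<lambda>x :: 'c ^ 'k. \<forall>j. x $ j \<in> grid (h $ j) (d $ j) (w $ j)"
  have unif: "\<exists>t>0. \<forall>j. ord_ge t (x $ j)" if x: "?grid x" for x :: "'c ^ 'k"
  proof -
    obtain t where t: "\<And>j. t j > 0" "\<And>j. ord_ge (t j) (x $ j)"
    proof -
      have "\<forall>j. \<exists>t>0. ord_ge t (x $ j)" using grid_ord_pos[OF w(1)] x by blast
      then show ?thesis using that by metis
    qed
    have "Min (range t) > 0" using t(1) by (subst Min_gr_iff) auto
    moreover have "ord_ge (Min (range t)) (x $ j)" for j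
      by (rule ord_ge_mono[OF t(2)]) (auto intro: Min_le)
    ultimately show ?thesis by blast
  qed
  have "\<forall>m x. ?grid x \<longrightarrow> partial_eval f (- R) m x = 0" if "finite R" for R
    using that
  proof (induction R)
    case empty
    then show ?case using vanish by (simp add: partial_eval_UNIV)
  next
    case (insert j R)
    let ?S = "- insert j R"
    have jS: "j \<notin> ?S" by simp
    have S: "- R = insert j ?S" using insert.hyps by auto
    show ?case
    proof (intro allI impI)
      fix m x assume x: "?grid x"
      let ?c = "\<lambda>l. partial_eval f ?S (vec_upd m j l) x"
      obtain t where t: "t > 0" "\<And>i. ord_ge t (x $ i)" using unif[OF x] by blast
      obtain D where D: "\<And>m. ord_ge (D - (\<Sum>i\<in>-?S. h $ i * real (ell p (m $ i)))) (partial_eval f ?S m x)"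
        using partial_eval_bound[where S = ?S, OF growth h t(2) t(1)] by blast
      have "?c l = 0" for l
      proof (rule one_variable_uniqueness)
        show "h $ j \<ge> 0" by (rule h)
        show "ord_ge 1 (w $ j - 1)" "\<And>n. n > 0 \<Longrightarrow> (w $ j) ^ n \<noteq> 1" by (fact w)+
        show "ord_ge ((D - (\<Sum>i\<in>R. h $ i * real (ell p (m $ i)))) - h $ j * real (ell p l)) (?c l)" for l
        proof -
          have "(\<Sum>i\<in>-?S. h $ i * real (ell p (vec_upd m j l $ i)))
              = h $ j * real (ell p l) + (\<Sum>i\<in>R. h $ i * real (ell p (vec_upd m j l $ i)))"
            using insert.hyps by simp
          also have "(\<Sum>i\<in>R. h $ i * real (ell p (vec_upd m j l $ i))) = (\<Sum>i\<in>R. h $ i * real (ell p (m $ i)))"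
            using insert.hyps by (intro sum.cong) auto
          finally show ?thesis using D[of "vec_upd m j l"] by (simp add: algebra_simps)
        qed
        fix i :: int and \<epsilon> :: 'c
        assume i: "i \<in> {d $ j..d $ j + \<lfloor>h $ j\<rfloor>}" "\<epsilon> \<in> mu_p_infinity p"
        \<comment> \<open>varying the \<open>j\<close>-th coordinate over its prescribed zeros stays in the grid\<close>
        define y where "y = vec_upd x j ((w $ j) powi i * \<epsilon> - 1)"
        have y: "?grid y" using x i by (auto simp: y_def grid_def)
        obtain t where t: "t > 0" "\<And>i. ord_ge t (y $ i)" using unif[OF y] by blast
        have "0 = partial_eval f (- R) m y" using insert.IH y by simp
        also have "\<dots> = series_at (\<lambda>l. partial_eval f ?S (vec_upd m j l) y) (y $ j)"
          unfolding S by (rule partial_eval_insert[OF growth h t(2) t(1) jS])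
        also have "(\<lambda>l. partial_eval f ?S (vec_upd m j l) y) = ?c"
          by (intro ext partial_eval_cong) (auto simp: y_def)
        finally show "series_at ?c ((w $ j) powi i * \<epsilon> - 1) = 0" by (simp add: y_def)
      qed
      from this[of "m $ j"] show "partial_eval f ?S m x = 0"
        by (simp add: vec_upd_same)
    qed
  qed
  from this[of UNIV] have *: "?grid x \<Longrightarrow> f m = 0" for x :: "'c ^ 'k"
    by (auto simp: partial_eval_empty)
  show ?thesis
  proof (rule *, rule allI)
    fix j
    have "(w $ j) powi (d $ j) * 1 - 1 \<in> grid (h $ j) (d $ j) (w $ j)"
      using h[of j] unfolding grid_def mu_p_infinity_def by fastforce
    then show "(\<chi> j. (w $ j) powi (d $ j) * 1 - 1) $ j \<in> grid (h $ j) (d $ j) (w $ j)" by simp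
  qed
qed

end

section \<open>The uniqueness theorem\<close>

theorem theoremA:
  fixes p :: nat
    and ord :: "'c::{field_char_0, metric_space} \<Rightarrow> ereal"
    and K :: "'c set"
    and u :: "'c ^ 'k::finite"
    and h :: "real ^ 'k"
    and d :: "int ^ 'k"
    and f :: "('c, 'k) mpowser"
  assumes "padic_complex_field p ord"
    and "is_subfield K" and "complete K"
    and "\<And>j. topological_generator (one_plus_2p_Zp p ord) (u $ j)"
    and "\<And>j. ereal (h $ j) \<in> ord ` (valuation_ring ord K - {0})"
    and "f \<in> H_space p ord K h"
    and "\<And>(i :: int ^ 'k) (\<epsilon> :: 'c ^ 'k).
           i \<in> {d .. d + floor_vec h} \<Longrightarrow> (\<And>j. \<epsilon> $ j \<in> mu_p_infinity p) \<Longrightarrow>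
           mpowser_eval f (\<chi> j. (u $ j) powi (i $ j) * \<epsilon> $ j - 1) = 0"
  shows "f = (\<lambda>n. 0)"
proof
  fix m
  interpret padic_complex_field p ord by fact
  have "- \<infinity> < (INF n. ord (f n) + ereal (h \<bullet> ell_vec p n))"
    using assms(6) by (simp add: H_space_def)
  then obtain C where C: "ereal C < (INF n. ord (f n) + ereal (h \<bullet> ell_vec p n))"
    using ereal_dense2 by blast
  show "f m = 0"
  proof (rule several_variables_uniqueness)
    show "ord_ge (C - h \<bullet> ell_vec p n) (f n)" for n
    proof -
      have "ereal C \<le> ord (f n) + ereal (h \<bullet> ell_vec p n)"
        using C by (meson INF_lower UNIV_I less_imp_le order_trans)
      then show ?thesis by (cases "ord (f n)") (auto simp: ord_ge_def)
    qed
    show "h $ i \<ge> 0" for i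
    proof -
      obtain x where "ereal (h $ i) = ord x" "0 \<le> ord x"
        using assms(5)[of i] by (auto simp: valuation_ring_def)
      then have "0 \<le> ereal (h $ i)" by metis
      then show ?thesis by simp
    qed
    show "ord_ge 1 (u $ j - 1)" "n > 0 \<Longrightarrow> (u $ j) ^ n \<noteq> 1" for j n
      using topological_generator_facts[OF assms(4)] by blast+
    fix x assume "\<And>j. x $ j \<in> grid (h $ j) (d $ j) (u $ j)"
    then have "\<forall>j. \<exists>i \<epsilon>. x $ j = (u $ j) powi i * \<epsilon> - 1 \<and> i \<in> {d $ j..d $ j + \<lfloor>h $ j\<rfloor>}
        \<and> \<epsilon> \<in> mu_p_infinity p"
      unfolding grid_def by blast
    then obtain i \<epsilon> where ie: "\<And>j. x $ j = (u $ j) powi (i j) * \<epsilon> j - 1"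
        "\<And>j. i j \<in> {d $ j..d $ j + \<lfloor>h $ j\<rfloor>}" "\<And>j. \<epsilon> j \<in> mu_p_infinity p"
      by metis
    have "mpowser_eval f (\<chi> j. (u $ j) powi ((\<chi> j. i j) $ j) * (\<chi> j. \<epsilon> j) $ j - 1) = 0"
      by (rule assms(7)) (use ie in \<open>auto simp: less_eq_vec_def floor_vec_def\<close>)
    moreover have "(\<chi> j. (u $ j) powi ((\<chi> j. i j) $ j) * (\<chi> j. \<epsilon> j) $ j - 1) = x"
      using ie(1) by (simp add: vec_eq_iff)
    ultimately show "mpowser_eval f x = 0" by simp
  qed
qed

end
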